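(* Let $c>1$ be fixed. For each $n$, let $(\sigma_t)_{t\ge 0}$ be the interchange process on the complete graph $K_n$ started from the identity, let $t=c/n$, and let $C(t)$ denote the length of the largest cycle of $\sigma_t$. Then $$\lim_{\varepsilon\to0^+}\ \liminf_{n\to\infty}\ \mathbb{P}\big(C(t)>n\varepsilon\big)=1.$$
   Context: The interchange process on $K_n$ is the continuous-time random walk $(\sigma_t)_{t\ge0}$ on the symmetric group $S_n$, with $\sigma_0=\mathrm{id}$, in which each of the $\binom n2$ transpositions $(i,j)$, $1\le i<j\le n$, is applied (multiplied to the current permutation) at rate $1$, independently. Equivalently, its generator, viewed as an element of the group algebra $\mathbb{C}[S_n]$, is $Q=\sum_{i<j}[(i,j)-\mathrm{id}]$, and $\mathbb{P}(\sigma_t=s)$ is the coefficient of $s$ in $e^{tQ}$. *)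

theory Defs
  imports "HOL-Probability.Probability" "HOL-Combinatorics.Combinatorics"
begin

text \<open>
  The symmetric group on \<open>n\<close> letters is \<open>{\<pi>. \<pi> permutes {1..n}}\<close> with composition as
  product. An element \<open>\<Sum>\<pi>. f \<pi> \<cdot> \<pi>\<close> of its complex group algebra is represented by its
  coefficient function \<open>f\<close>; only the values at permutations of \<open>{1..n}\<close> matter.
\<close>

type_synonym ga = "(nat \<Rightarrow> nat) \<Rightarrow> complex"

definition ga_basis :: "(nat \<Rightarrow> nat) \<Rightarrow> ga" where
  "ga_basis \<rho> = (\<lambda>\<pi>. if \<pi> = \<rho> then 1 else 0)"

definition ga_mult :: "nat \<Rightarrow> ga \<Rightarrow> ga \<Rightarrow> ga" where
  "ga_mult n f g = (\<lambda>\<pi>. \<Sum>\<rho> | \<rho> permutes {1..n}. f \<rho> * g (inv \<rho> \<circ> \<pi>))"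

primrec ga_power :: "nat \<Rightarrow> ga \<Rightarrow> nat \<Rightarrow> ga" where
  "ga_power n f 0 = ga_basis id"
| "ga_power n f (Suc k) = ga_mult n f (ga_power n f k)"

text \<open>The algebra is finite-dimensional, so the exponential series converges coefficientwise.\<close>

definition ga_exp :: "nat \<Rightarrow> ga \<Rightarrow> ga" where
  "ga_exp n f = (\<lambda>\<pi>. \<Sum>k. ga_power n f k \<pi> / fact k)"

definition interchange_generator :: "nat \<Rightarrow> ga" where
  "interchange_generator n = (\<lambda>\<pi>.
     \<Sum>(i, j) \<in> {(i, j). 1 \<le> i \<and> i < j \<and> j \<le> n}. ga_basis (Transposition.transpose i j) \<pi> - ga_basis id \<pi>)"

text \<open>
  The continuous-time random walk on the symmetric group, started at the identity, with generator
  \<open>Q = interchange_generator n\<close>: the conditional probability of moving from \<open>\<pi>\<close> to \<open>\<rho>\<close> in time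
  \<open>s\<close>, given the past, is the coefficient of \<open>\<pi>\<^sup>-\<^sup>1 \<rho>\<close> in \<open>exp (s Q)\<close>. The Markov property is stated
  through finite-dimensional distributions, without dividing by the probability of the past.
\<close>

locale interchange_process = prob_space M
  for M :: "'a measure" and n :: nat and \<sigma> :: "real \<Rightarrow> 'a \<Rightarrow> nat \<Rightarrow> nat" +
  assumes measurable_state:
      "0 \<le> t \<Longrightarrow> \<sigma> t \<in> M \<rightarrow>\<^sub>M count_space {\<pi>. \<pi> permutes {1..n}}"
    and start: "AE \<omega> in M. \<sigma> 0 \<omega> = id"
    and right_continuous:
      "AE \<omega> in M. \<forall>t\<ge>0. \<forall>\<^sub>F s in at_right t. \<sigma> s \<omega> = \<sigma> t \<omega>"
    and transition:
      "\<lbrakk>0 \<le> u 0; \<And>i. i < k \<Longrightarrow> u i \<le> u (Suc i); u k \<le> t;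
        \<And>i. i \<le> k \<Longrightarrow> \<pi> i permutes {1..n}; \<rho> permutes {1..n}\<rbrakk> \<Longrightarrow>
       complex_of_real (prob {\<omega> \<in> space M. (\<forall>i\<le>k. \<sigma> (u i) \<omega> = \<pi> i) \<and> \<sigma> t \<omega> = \<rho>}) =
       complex_of_real (prob {\<omega> \<in> space M. \<forall>i\<le>k. \<sigma> (u i) \<omega> = \<pi> i}) *
         ga_exp n (\<lambda>\<tau>. complex_of_real (t - u k) * interchange_generator n \<tau>) (inv (\<pi> k) \<circ> \<rho>)"

text \<open>Fixed points count as cycles of length 1. The value for \<open>n = 0\<close> is unspecified.\<close>

definition largest_cycle_length :: "nat \<Rightarrow> (nat \<Rightarrow> nat) \<Rightarrow> nat" where
  "largest_cycle_length n \<pi> = Max ((\<lambda>x. card (orbit \<pi> x)) ` {1..n})"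

end

theory Submission
  imports Defs "HOL-Real_Asymp.Real_Asymp"
begin

text \<open>
  Give a cycle of length \<open>k\<close> the weight \<open>X\<^sup>k + Y\<^sup>k - X\<^sup>k Y\<^sup>k\<close> and let \<open>g\<close> be the product of the weights
  of the cycles of a permutation. The cut-and-join rule for multiplication by a transposition shows
  that the generator maps \<open>\<Delta> g\<close>, with \<open>\<Delta> = 1/(1 - Y) - 1/(1 - X)\<close>, to
  \<open>- (X \<partial>\<^sub>X) (Y \<partial>\<^sub>Y) (\<Delta> g)\<close>. On the coefficient of \<open>X\<^sup>k\<close> this is the transport equation
  \<open>\<partial>\<^sub>t v = - k Y \<partial>\<^sub>Y v\<close>, so at time \<open>t\<close> the variable \<open>Y\<close> is replaced by \<open>Y e\<^sup>-\<^sup>k\<^sup>t\<close>. At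
  \<open>Y = 1\<close> the coefficient is the number of points in \<open>k\<close>-cycles minus 1, whose mean is therefore
  explicit: up to an error of at most 1 it is \<open>(n choose k) (1 - q)\<^sup>k\<^sup>-\<^sup>1 q\<^sup>n\<^sup>-\<^sup>k\<close> with \<open>q = e\<^sup>-\<^sup>k\<^sup>t\<close>.

  For \<open>t = c/n\<close> and fixed \<open>k\<close> this is asymptotic to \<open>n\<close> times the Borel weight, and the Borel
  weights sum to less than 1 when \<open>c > 1\<close>; for \<open>K < k \<le> \<epsilon> n\<close> the contributions sum to at most
  \<open>\<epsilon> n\<close> plus an exponentially small multiple of \<open>n\<close>. The number of points in cycles of length at
  most \<open>K\<close> changes by at most \<open>2 K\<close> under a transposition, hence it is concentrated. So with high
  probability a positive fraction of the points is in cycles longer than \<open>K\<close>, and by Markov's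
  inequality these cannot all be in cycles of length at most \<open>\<epsilon> n\<close>.
\<close>

section \<open>Orbits after multiplication by a transposition\<close>

text \<open>\<open>funpow_dist1 f x x\<close> is the first return time to \<open>x\<close>; the
  iterates before it list the orbit without repetition, so it equals the size of the orbit.\<close>

lemma orbit_enum:
  assumes "f permutes S" "finite S"
  obtains "(f ^^ card (orbit f x)) x = x" "0 < card (orbit f x)"
    "bij_betw (\<lambda>m. (f ^^ m) x) {..<card (orbit f x)} (orbit f x)"
proof -
  have self: "x \<in> orbit f x"
    using assms by (intro permutation_self_in_orbit) (auto simp: permutation_permutes)
  define r where "r = funpow_dist1 f x x"
  have bij: "bij_betw (\<lambda>m. (f ^^ m) x) {..<r} (orbit f x)"
    unfolding r_def bij_betw_def lessThan_atLeast0
    using inj_on_funpow_dist1[OF self] orbit_conv_funpow_dist1[OF self] by simp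
  have "card (orbit f x) = r"
    using bij_betw_same_card[OF bij] by simp
  moreover have "(f ^^ r) x = x"
    unfolding r_def by (rule funpow_dist1_prop[OF self])
  moreover have "0 < r" by (simp add: r_def)
  ultimately show ?thesis using that bij by metis
qed

lemma orbit_eq_iff:
  assumes "f permutes S" "finite S"
  shows "orbit f x = orbit f y \<longleftrightarrow> y \<in> orbit f x"
  by (metis assms cyclic_on_alldef cyclic_on_orbit permutation_permutes permutation_self_in_orbit)

lemma orbit_transpose_other:
  assumes "f permutes S" "finite S" "i \<notin> orbit f x" "j \<notin> orbit f x"
  shows "orbit (Transposition.transpose i j \<circ> f) x = orbit f x"
proof (rule orbit_cong)
  show "x \<in> orbit f x"
    using assms by (intro permutation_self_in_orbit) (auto simp: permutation_permutes)
next
  fix s assume "s \<in> orbit f x"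
  then have "f s \<in> orbit f x" by (rule orbit.step)
  then show "(Transposition.transpose i j \<circ> f) s = f s"
    using assms(3,4) by (auto simp: Transposition.transpose_def)
qed

text \<open>The composite differs from \<open>f\<close> only where the value of \<open>f\<close> is
  \<open>i\<close> or \<open>j\<close>, so the iterates agree until one of these two points is
  hit.\<close>

lemma funpow_transpose_comp:
  fixes f :: "'a \<Rightarrow> 'a"
  assumes "\<And>m. 0 < m \<Longrightarrow> m < r \<Longrightarrow> (f ^^ m) x \<noteq> i \<and> (f ^^ m) x \<noteq> j" and "m < r"
  shows "((Transposition.transpose i j \<circ> f) ^^ m) x = (f ^^ m) x"
  using \<open>m < r\<close>
proof (induction m)
  case (Suc m)
  then show ?case using assms(1)[of "Suc m"] by (auto simp: Transposition.transpose_def)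
qed simp

lemma funpow_transpose_comp_last:
  fixes f :: "'a \<Rightarrow> 'a"
  assumes "\<And>m. 0 < m \<Longrightarrow> m < r \<Longrightarrow> (f ^^ m) x \<noteq> i \<and> (f ^^ m) x \<noteq> j" and "0 < r"
  shows "((Transposition.transpose i j \<circ> f) ^^ r) x = Transposition.transpose i j ((f ^^ r) x)"
proof -
  obtain m where m: "r = Suc m" using \<open>0 < r\<close> by (cases r) auto
  show ?thesis
    using funpow_transpose_comp[OF assms(1), of r m] by (simp add: m)
qed

text \<open>The path from \<open>i\<close> would reach \<open>j\<close> after \<open>l\<close> steps
  but is sent back to \<open>i\<close>; the path from \<open>j\<close> would reach \<open>i\<close>
  after the remaining steps of the old orbit but is sent back to \<open>j\<close>.\<close>

lemma orbit_transpose_split: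
  assumes f: "f permutes S" "finite S" and l: "0 < l" "l < card (orbit f i)"
    and j: "j = (f ^^ l) i"
  shows "orbit (Transposition.transpose i j \<circ> f) i = (\<lambda>m. (f ^^ m) i) ` {..<l}"
    and "orbit (Transposition.transpose i j \<circ> f) j = (\<lambda>m. (f ^^ m) i) ` {l..<card (orbit f i)}"
    and "card (orbit (Transposition.transpose i j \<circ> f) i) = l"
    and "card (orbit (Transposition.transpose i j \<circ> f) j) = card (orbit f i) - l"
proof -
  let ?k = "card (orbit f i)" and ?g = "Transposition.transpose i j \<circ> f"
  obtain kk: "(f ^^ ?k) i = i" and k0: "0 < ?k"
    and bij: "bij_betw (\<lambda>m. (f ^^ m) i) {..<?k} (orbit f i)"
    by (rule orbit_enum[OF f])
  have inj: "(f ^^ a) i = (f ^^ b) i \<longleftrightarrow> a = b" if "a < ?k" "b < ?k" for a b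
    using bij_betw_imp_inj_on[OF bij] that by (auto simp: inj_on_def)
  have ne: "(f ^^ m) i \<noteq> i \<and> (f ^^ m) i \<noteq> j" if "0 < m" "m < l" for m
    using inj[of m 0] inj[of m l] that l j by auto
  have ne': "(f ^^ m) j \<noteq> i \<and> (f ^^ m) j \<noteq> j" if "0 < m" "m < ?k - l" for m
    using inj[of "m + l" 0] inj[of "m + l" l] that l j by (auto simp: funpow_add)
  have gi: "(?g ^^ m) i = (f ^^ m) i" if "m < l" for m
    by (rule funpow_transpose_comp[OF ne that]) auto
  have "(?g ^^ l) i = i"
    using funpow_transpose_comp_last[of l f i i j] ne l j by simp
  then have "orbit ?g i = {(?g ^^ m) i |m. m < l}"
    using l by (intro orbit_altdef_bounded)
  also have "\<dots> = (\<lambda>m. (?g ^^ m) i) ` {..<l}" by auto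
  also have "\<dots> = (\<lambda>m. (f ^^ m) i) ` {..<l}" by (rule image_cong) (auto simp: gi simp del: o_apply)
  finally show A: "orbit ?g i = (\<lambda>m. (f ^^ m) i) ` {..<l}" .
  have gj: "(?g ^^ m) j = (f ^^ (m + l)) i" if "m < ?k - l" for m
    using funpow_transpose_comp[OF ne' that] by (auto simp: j funpow_add)
  have "(f ^^ (?k - l)) j = i"
    using l kk by (simp add: j flip: funpow_add[THEN fun_cong, unfolded o_apply])
  then have "(?g ^^ (?k - l)) j = j"
    using funpow_transpose_comp_last[of "?k - l" f j i j] ne' l by simp
  then have "orbit ?g j = {(?g ^^ m) j |m. m < ?k - l}"
    using l by (intro orbit_altdef_bounded) auto
  also have "\<dots> = (\<lambda>m. (?g ^^ m) j) ` {..<?k - l}" by auto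
  also have "\<dots> = (\<lambda>m. (f ^^ (m + l)) i) ` {..<?k - l}" by (rule image_cong) (auto simp: gj)
  also have "\<dots> = (\<lambda>m. (f ^^ m) i) ` ((\<lambda>m. m + l) ` {..<?k - l})" by (simp add: image_image)
  also have "(\<lambda>m. m + l) ` {..<?k - l} = {l..<?k}"
    using l by (simp add: lessThan_atLeast0)
  finally show B: "orbit ?g j = (\<lambda>m. (f ^^ m) i) ` {l..<?k}" .
  have "inj_on (\<lambda>m. (f ^^ m) i) {..<l}" "inj_on (\<lambda>m. (f ^^ m) i) {l..<?k}"
    using bij_betw_imp_inj_on[OF bij] l by (auto elim!: inj_on_subset)
  then show "card (orbit ?g i) = l" "card (orbit ?g j) = ?k - l"
    unfolding A B by (simp_all add: card_image)
qed

text \<open>The path from \<open>i\<close> runs through its old orbit, is sent to \<open>j\<close>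
  instead of closing up, runs through the orbit of \<open>j\<close> and only then returns to
  \<open>i\<close>.\<close>

lemma orbit_transpose_merge:
  assumes f: "f permutes S" "finite S" and "j \<notin> orbit f i"
  shows "orbit (Transposition.transpose i j \<circ> f) i = orbit f i \<union> orbit f j"
proof -
  let ?k = "card (orbit f i)" and ?l = "card (orbit f j)" and ?g = "Transposition.transpose i j \<circ> f"
  obtain ki: "(f ^^ ?k) i = i" and k0: "0 < ?k"
    and bi: "bij_betw (\<lambda>m. (f ^^ m) i) {..<?k} (orbit f i)"
    by (rule orbit_enum[OF f])
  obtain lj: "(f ^^ ?l) j = j" and l0: "0 < ?l"
    and bj: "bij_betw (\<lambda>m. (f ^^ m) j) {..<?l} (orbit f j)"
    by (rule orbit_enum[OF f])
  have ij: "i \<notin> orbit f j" using assms orbit_eq_iff[OF f, of i j] orbit_eq_iff[OF f, of j i] by auto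
  have injd: "(f ^^ m) x \<noteq> x"
    if "bij_betw (\<lambda>m. (f ^^ m) x) {..<r} (orbit f x)" "0 < m" "m < r" for m r x
    using bij_betw_imp_inj_on[OF that(1)] inj_onD[of "\<lambda>m. (f ^^ m) x" "{..<r}" m 0] that by auto
  have mem: "(f ^^ m) x \<in> orbit f x" for m x
    using f by (intro funpow_in_orbit permutation_self_in_orbit) (auto simp: permutation_permutes)
  have ne: "(f ^^ m) i \<noteq> i \<and> (f ^^ m) i \<noteq> j" if "0 < m" "m < ?k" for m
    using injd[OF bi that] mem[of m i] assms(3) by metis
  have ne': "(f ^^ m) j \<noteq> i \<and> (f ^^ m) j \<noteq> j" if "0 < m" "m < ?l" for m
    using injd[OF bj that] mem[of m j] ij by metis
  have gi: "(?g ^^ m) i = (f ^^ m) i" if "m < ?k" for m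
    by (rule funpow_transpose_comp[OF ne that]) auto
  have gj: "(?g ^^ m) j = (f ^^ m) j" if "m < ?l" for m
    by (rule funpow_transpose_comp[OF ne' that]) auto
  have gki: "(?g ^^ ?k) i = j"
    using funpow_transpose_comp_last[of ?k f i i j] ne k0 ki by simp
  have glj: "(?g ^^ ?l) j = i"
    using funpow_transpose_comp_last[of ?l f j i j] ne' l0 lj by simp
  have gkl: "(?g ^^ (m + ?k)) i = (?g ^^ m) j" for m
    using gki by (simp add: funpow_add)
  have "orbit ?g i = {(?g ^^ m) i |m. m < ?l + ?k}"
    using k0 gkl[of ?l] glj by (intro orbit_altdef_bounded) auto
  also have "\<dots> = (\<lambda>m. (?g ^^ m) i) ` {..<?l + ?k}" by auto
  also have "{..<?l + ?k} = {..<?k} \<union> (\<lambda>m. m + ?k) ` {..<?l}"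
    by (auto simp: lessThan_atLeast0)
  also have "(\<lambda>m. (?g ^^ m) i) ` \<dots> = (\<lambda>m. (?g ^^ m) i) ` {..<?k} \<union> (\<lambda>m. (?g ^^ m) j) ` {..<?l}"
    by (simp add: image_Un image_image gkl)
  also have "(\<lambda>m. (?g ^^ m) i) ` {..<?k} = orbit f i"
    using gi bij_betw_imp_surj_on[OF bi, symmetric] by (auto intro!: image_cong)
  also have "(\<lambda>m. (?g ^^ m) j) ` {..<?l} = orbit f j"
    using gj bij_betw_imp_surj_on[OF bj, symmetric] by (auto intro!: image_cong)
  finally show ?thesis .
qed

section \<open>The cut-and-join rule\<close>

definition cycles :: "'a set \<Rightarrow> ('a \<Rightarrow> 'a) \<Rightarrow> 'a set set" where
  "cycles S f = orbit f ` S"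

definition cycle_prod :: "(nat \<Rightarrow> 'r::comm_ring_1) \<Rightarrow> 'a set \<Rightarrow> ('a \<Rightarrow> 'a) \<Rightarrow> 'r" where
  "cycle_prod p S f = (\<Prod>C\<in>cycles S f. p (card C))"

section \<open>The partition of a finite set into the cycles of a permutation\<close>

context
  fixes S :: "'a set" and f :: "'a \<Rightarrow> 'a"
  assumes S: "finite S" and f: "f permutes S"
begin

lemma in_own_orbit: "x \<in> orbit f x"
  using f S by (intro permutation_self_in_orbit) (auto simp: permutation_permutes)

lemma finite_cycles: "finite (cycles S f)"
  using S by (simp add: cycles_def)

lemma cycles_orbit: "C \<in> cycles S f \<Longrightarrow> x \<in> C \<Longrightarrow> orbit f x = C"
  using orbit_eq_iff[OF f S] by (auto simp: cycles_def)

lemma cycles_subset: "C \<in> cycles S f \<Longrightarrow> C \<subseteq> S"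
  using permutes_orbit_subset[OF f] by (auto simp: cycles_def)

lemma finite_cycle: "C \<in> cycles S f \<Longrightarrow> finite C"
  using cycles_subset S finite_subset by blast

lemma cycles_disjoint: "A \<in> cycles S f \<Longrightarrow> B \<in> cycles S f \<Longrightarrow> A \<noteq> B \<Longrightarrow> A \<inter> B = {}"
  using cycles_orbit by blast

lemma Union_cycles: "\<Union>(cycles S f) = S"
  using cycles_subset in_own_orbit by (auto simp: cycles_def)

lemma cycle_nonempty: "C \<in> cycles S f \<Longrightarrow> C \<noteq> {}"
  using in_own_orbit by (auto simp: cycles_def)

lemma card_cycle_pos: "C \<in> cycles S f \<Longrightarrow> 0 < card C"
  using cycle_nonempty finite_cycle by (simp add: card_gt_0_iff)

lemma sum_cycles: "(\<Sum>x\<in>S. h x) = (\<Sum>C\<in>cycles S f. \<Sum>x\<in>C. h x)"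
  using sum.Union_disjoint[of "cycles S f" h] finite_cycle cycles_disjoint
  by (simp add: Union_cycles)

text \<open>A cycle outside \<open>D\<close> contains neither \<open>i\<close> nor \<open>j\<close>
  and survives unchanged, so only the points covered by \<open>D\<close> need new orbits. A merge
  uses it with two cycles in \<open>D\<close>, a split with one.\<close>

lemma cycles_transpose:
  assumes "D \<subseteq> cycles S f" "i \<in> \<Union>D" "j \<in> \<Union>D"
  shows "cycles S (Transposition.transpose i j \<circ> f) =
    orbit (Transposition.transpose i j \<circ> f) ` \<Union>D \<union> (cycles S f - D)"
proof -
  let ?g = "Transposition.transpose i j \<circ> f"
  have S_eq: "S = \<Union>D \<union> \<Union>(cycles S f - D)"
    using assms(1) Union_cycles by blast
  have "orbit ?g ` \<Union>(cycles S f - D) = orbit f ` \<Union>(cycles S f - D)"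
  proof (rule image_cong[OF refl])
    fix x assume "x \<in> \<Union>(cycles S f - D)"
    then obtain C where C: "C \<in> cycles S f" "C \<notin> D" "x \<in> C" by auto
    then have "i \<notin> orbit f x" "j \<notin> orbit f x"
      using assms cycles_disjoint cycles_orbit[OF C(1,3)] by blast+
    then show "orbit ?g x = orbit f x"
      by (intro orbit_transpose_other[OF f S])
  qed
  also have "\<dots> = cycles S f - D"
    using cycles_orbit cycle_nonempty by (fastforce simp: image_iff)
  finally show ?thesis
    unfolding cycles_def[of S ?g] by (subst S_eq) (simp add: image_Un)
qed

lemma cycle_prod_merge:
  assumes A: "A \<in> cycles S f" "i \<in> A" and B: "B \<in> cycles S f" "j \<in> B" and "A \<noteq> B"
  shows "cycle_prod p S (Transposition.transpose i j \<circ> f) =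
    p (card A + card B) * (\<Prod>C\<in>cycles S f - {A, B}. p (card C))"
proof -
  let ?g = "Transposition.transpose i j \<circ> f"
  have g: "?g permutes S"
    using A B cycles_subset f by (intro permutes_compose permutes_swap_id) auto
  have AB: "A \<inter> B = {}" using cycles_disjoint A B \<open>A \<noteq> B\<close> by blast
  have oi: "orbit f i = A" and oj: "orbit f j = B" using cycles_orbit A B by auto
  have gi: "orbit ?g i = A \<union> B"
    using orbit_transpose_merge[OF f S, of j i] AB B oi oj by auto
  have "orbit ?g x = A \<union> B" if "x \<in> A \<union> B" for x
    using orbit_eq_iff[OF g S, of i x] that gi by auto
  then have "orbit ?g ` \<Union>{A, B} = {A \<union> B}"
    using A by auto
  then have "cycles S ?g = insert (A \<union> B) (cycles S f - {A, B})"
    using cycles_transpose[of "{A, B}" i j] A B by auto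
  moreover have "A \<union> B \<notin> cycles S f - {A, B}"
    using cycles_disjoint[of "A \<union> B" A] A by auto
  ultimately show ?thesis
    using AB finite_cycle A B by (simp add: cycle_prod_def finite_cycles card_Un_disjoint)
qed

text \<open>Writing the second point as an iterate of the first makes the sizes of the two pieces
  explicit.\<close>

lemma cycle_prod_split:
  assumes A: "A \<in> cycles S f" "i \<in> A" and l: "0 < l" "l < card A"
  shows "cycle_prod p S (Transposition.transpose i ((f ^^ l) i) \<circ> f) =
    p l * p (card A - l) * (\<Prod>C\<in>cycles S f - {A}. p (card C))"
proof -
  define j where "j = (f ^^ l) i"
  let ?g = "Transposition.transpose i j \<circ> f"
  have oi: "orbit f i = A" using cycles_orbit A by auto
  have jA: "j \<in> A"
    unfolding j_def oi[symmetric] by (intro funpow_in_orbit in_own_orbit)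
  have g: "?g permutes S"
    using A jA cycles_subset f by (intro permutes_compose permutes_swap_id) auto
  note sp = orbit_transpose_split[OF f S l(1) _ j_def, unfolded oi, OF l(2)]
  obtain bij: "bij_betw (\<lambda>m. (f ^^ m) i) {..<card A} A"
    using orbit_enum[OF f S, of i thesis] by (simp add: oi)
  define A1 A2 where "A1 = orbit ?g i" and "A2 = orbit ?g j"
  have "A1 \<union> A2 = (\<lambda>m. (f ^^ m) i) ` ({..<l} \<union> {l..<card A})"
    unfolding A1_def A2_def sp by blast
  also have "{..<l} \<union> {l..<card A} = {..<card A}" using l by auto
  also have "(\<lambda>m. (f ^^ m) i) ` \<dots> = A" by (rule bij_betw_imp_surj_on[OF bij])
  finally have un: "A1 \<union> A2 = A" .
  have cA: "card A1 = l" "card A2 = card A - l" unfolding A1_def A2_def by (rule sp)+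
  \<comment> \<open>Disjointness of the pieces is obtained by counting: their sizes add up to the
    size of their union.\<close>
  have "card (A1 \<union> A2) = card A1 + card A2" using un cA l by simp
  moreover have fin: "finite A1" "finite A2" using un finite_cycle[OF A(1)] by auto
  ultimately have disj: "A1 \<inter> A2 = {}"
    using card_Un_Int[of A1 A2] by auto
  have ne: "A1 \<noteq> {}" "A2 \<noteq> {}" using cA l by auto
  have "orbit ?g x = A1" if "x \<in> A1" for x
    using orbit_eq_iff[OF g S, of i x] that A1_def by auto
  moreover have "orbit ?g x = A2" if "x \<in> A2" for x
    using orbit_eq_iff[OF g S, of j x] that A2_def by auto
  ultimately have "orbit ?g ` A = {A1, A2}"
    using ne unfolding un[symmetric] by (auto simp: image_iff)
  then have "cycles S ?g = insert A1 (insert A2 (cycles S f - {A}))"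
    using cycles_transpose[of "{A}" i j] A jA by auto
  moreover have "A1 \<notin> cycles S f - {A}" "A2 \<notin> cycles S f - {A}"
    using cycles_disjoint[of A1 A] cycles_disjoint[of A2 A] A ne un by auto
  moreover have "A1 \<noteq> A2" using ne disj by auto
  ultimately have "cycle_prod p S ?g = p l * p (card A - l) * (\<Prod>C\<in>cycles S f - {A}. p (card C))"
    unfolding cycle_prod_def using finite_cycles by (simp add: cA mult.assoc)
  then show ?thesis by (simp only: j_def)
qed

lemma cycle_prod_remove:
  "A \<in> cycles S f \<Longrightarrow> cycle_prod p S f = p (card A) * (\<Prod>C\<in>cycles S f - {A}. p (card C))"
  unfolding cycle_prod_def by (rule prod.remove[OF finite_cycles])

lemma cycle_prod_remove2:
  assumes "A \<in> cycles S f" "B \<in> cycles S f" "A \<noteq> B"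
  shows "cycle_prod p S f =
    p (card A) * p (card B) * (\<Prod>C\<in>cycles S f - {A, B}. p (card C))"
proof -
  have "cycles S f - {A, B} = cycles S f - {A} - {B}" by auto
  then show ?thesis
    using assms finite_cycles
    by (simp add: cycle_prod_remove[OF assms(1)] prod.remove[of "cycles S f - {A}" B] mult.assoc)
qed

text \<open>The ordered pairs are grouped by the cycles of \<open>i\<close> and \<open>j\<close>.
  For different cycles the summand depends only on these cycles, which gives the factor
  \<open>card A * card B\<close>. Within one cycle \<open>A\<close> it depends only on the number
  \<open>l\<close> of steps from \<open>i\<close> to \<open>j\<close>, which gives the factor
  \<open>card A\<close>. The products over the other cycles are kept, so that no division by weights
  occurs.\<close>

theorem cut_join:
  fixes p :: "nat \<Rightarrow> 'r::comm_ring_1"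
  shows "(\<Sum>i\<in>S. \<Sum>j\<in>S - {i}. cycle_prod p S (Transposition.transpose i j \<circ> f) - cycle_prod p S f) =
    (\<Sum>A\<in>cycles S f. \<Sum>B\<in>cycles S f - {A}. of_nat (card A * card B) *
       (p (card A + card B) - p (card A) * p (card B)) * (\<Prod>C\<in>cycles S f - {A, B}. p (card C))) +
    (\<Sum>A\<in>cycles S f. of_nat (card A) *
       (\<Sum>l=1..<card A. p l * p (card A - l) - p (card A)) * (\<Prod>C\<in>cycles S f - {A}. p (card C)))"
    (is "(\<Sum>i\<in>S. \<Sum>j\<in>S - {i}. ?h i j) = (\<Sum>A\<in>?O. \<Sum>B\<in>?O - {A}. ?m A B) + (\<Sum>A\<in>?O. ?s A)")
proof -
  have merge: "(\<Sum>j\<in>B. ?h i j) = of_nat (card B) *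
      ((p (card A + card B) - p (card A) * p (card B)) * (\<Prod>C\<in>?O - {A, B}. p (card C)))"
    if "A \<in> ?O" "i \<in> A" "B \<in> ?O - {A}" for A B i
  proof -
    have "?h i j = (p (card A + card B) - p (card A) * p (card B)) * (\<Prod>C\<in>?O - {A, B}. p (card C))"
      if "j \<in> B" for j
    proof -
      have "B \<in> ?O" "A \<noteq> B" using \<open>B \<in> ?O - {A}\<close> by auto
      then show ?thesis
        using cycle_prod_merge[of A i B j p] cycle_prod_remove2[of A B p] \<open>A \<in> ?O\<close> \<open>i \<in> A\<close> that
        by (simp add: left_diff_distrib)
    qed
    then show ?thesis by simp
  qed
  have split: "(\<Sum>j\<in>A - {i}. ?h i j) =
      (\<Sum>l=1..<card A. p l * p (card A - l) - p (card A)) * (\<Prod>C\<in>?O - {A}. p (card C))"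
    if "A \<in> ?O" "i \<in> A" for A i
  proof -
    have oi: "orbit f i = A" using cycles_orbit that by auto
    obtain bij: "bij_betw (\<lambda>m. (f ^^ m) i) {..<card A} A"
      using orbit_enum[OF f S, of i thesis] by (simp add: oi)
    \<comment> \<open>Every other point of the cycle is reached after exactly one number of steps
      between 1 and \<open>card A - 1\<close>; step 0 is \<open>i\<close> itself.\<close>
    have "bij_betw (\<lambda>m. (f ^^ m) i) ({..<card A} - {0}) (A - {(f ^^ 0) i})"
      using bij_betw_imp_inj_on[OF bij] bij_betw_imp_surj_on[OF bij] card_cycle_pos[OF that(1)]
      by (auto simp: bij_betw_def inj_on_image_set_diff[of _ "{..<card A}"] intro: inj_on_subset)
    moreover have "{..<card A} - {0} = {1..<card A}" by auto
    ultimately have "bij_betw (\<lambda>m. (f ^^ m) i) {1..<card A} (A - {i})" by simp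
    then have "(\<Sum>j\<in>A - {i}. ?h i j) = (\<Sum>l=1..<card A. ?h i ((f ^^ l) i))"
      by (rule sum.reindex_bij_betw[symmetric])
    also have "\<dots> = (\<Sum>l=1..<card A. (p l * p (card A - l) - p (card A)) * (\<Prod>C\<in>?O - {A}. p (card C)))"
      using that by (intro sum.cong refl)
        (simp add: cycle_prod_split cycle_prod_remove[OF that(1)] left_diff_distrib)
    finally show ?thesis by (simp add: sum_distrib_right)
  qed
  have "(\<Sum>j\<in>S - {i}. ?h i j) = (\<Sum>B\<in>?O - {A}. of_nat (card B) *
      ((p (card A + card B) - p (card A) * p (card B)) * (\<Prod>C\<in>?O - {A, B}. p (card C)))) +
      (\<Sum>l=1..<card A. p l * p (card A - l) - p (card A)) * (\<Prod>C\<in>?O - {A}. p (card C))"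
    if A: "A \<in> ?O" "i \<in> A" for A i
  proof -
    have S_eq: "S - {i} = \<Union>(?O - {A}) \<union> (A - {i})"
      using Union_cycles A cycles_disjoint by blast
    have "(\<Sum>j\<in>S - {i}. ?h i j) = (\<Sum>j\<in>\<Union>(?O - {A}). ?h i j) + (\<Sum>j\<in>A - {i}. ?h i j)"
      unfolding S_eq using finite_cycle A cycles_disjoint finite_cycles
      by (intro sum.union_disjoint) blast+
    also have "(\<Sum>j\<in>\<Union>(?O - {A}). ?h i j) = (\<Sum>B\<in>?O - {A}. \<Sum>j\<in>B. ?h i j)"
      using finite_cycle cycles_disjoint by (subst sum.Union_disjoint) auto
    also have "\<dots> = (\<Sum>B\<in>?O - {A}. of_nat (card B) *
      ((p (card A + card B) - p (card A) * p (card B)) * (\<Prod>C\<in>?O - {A, B}. p (card C))))"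
      by (intro sum.cong refl merge[OF A])
    also note split[OF A]
    finally show ?thesis .
  qed
  then have "(\<Sum>i\<in>S. \<Sum>j\<in>S - {i}. ?h i j) = (\<Sum>A\<in>?O. \<Sum>i\<in>A. (\<Sum>B\<in>?O - {A}. of_nat (card B) *
      ((p (card A + card B) - p (card A) * p (card B)) * (\<Prod>C\<in>?O - {A, B}. p (card C)))) +
      (\<Sum>l=1..<card A. p l * p (card A - l) - p (card A)) * (\<Prod>C\<in>?O - {A}. p (card C)))"
    unfolding sum_cycles[of "\<lambda>i. \<Sum>j\<in>S - {i}. ?h i j"] by simp
  also have "\<dots> = (\<Sum>A\<in>?O. (\<Sum>B\<in>?O - {A}. ?m A B) + ?s A)"
    by (intro sum.cong refl) (simp add: distrib_left sum_distrib_left mult_ac)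
  finally show ?thesis by (simp add: sum.distrib)
qed

end

section \<open>Formal power series in \<open>X\<close> with coefficients polynomial in \<open>Y\<close>\<close>

lemma derivation_prod:
  fixes \<delta> :: "'r::comm_ring_1 \<Rightarrow> 'r"
  assumes Leibniz: "\<And>a b. \<delta> (a * b) = \<delta> a * b + a * \<delta> b" and "finite I"
  shows "\<delta> (\<Prod>i\<in>I. u i) = (\<Sum>i\<in>I. \<delta> (u i) * (\<Prod>j\<in>I - {i}. u j))"
  using \<open>finite I\<close>
proof induction
  case empty
  \<comment> \<open>The Leibniz rule for \<open>1 * 1\<close> forces
    \<open>\<delta> 1 = 0\<close>.\<close>
  then show ?case using Leibniz[of 1 1] by simp
next
  case (insert x I)
  have "(\<Prod>j\<in>insert x I - {i}. u j) = u x * (\<Prod>j\<in>I - {i}. u j)" if "i \<in> I" for i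
  proof -
    have "insert x I - {i} = insert x (I - {i})" using insert that by auto
    then show ?thesis using insert by simp
  qed
  then have "(\<Sum>i\<in>I. \<delta> (u i) * (\<Prod>j\<in>insert x I - {i}. u j)) =
      u x * (\<Sum>i\<in>I. \<delta> (u i) * (\<Prod>j\<in>I - {i}. u j))"
    by (simp add: sum_distrib_left mult_ac)
  moreover have "insert x I - {x} = I" using insert by auto
  ultimately show ?case
    using insert by (simp add: Leibniz)
qed

lemma sum_off_diagonal_swap:
  fixes h :: "'b \<Rightarrow> 'b \<Rightarrow> 'c::ab_group_add"
  assumes "finite I"
  shows "(\<Sum>i\<in>I. \<Sum>j\<in>I - {i}. h i j) = (\<Sum>i\<in>I. \<Sum>j\<in>I - {i}. h j i)"
proof -
  have "(\<Sum>i\<in>I. \<Sum>j\<in>I - {i}. h i j) = (\<Sum>i\<in>I. \<Sum>j\<in>I. h i j) - (\<Sum>i\<in>I. h i i)" for h :: "'b \<Rightarrow> 'b \<Rightarrow> 'c"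
    unfolding sum_subtractf[symmetric] using assms
    by (intro sum.cong refl) (simp add: sum_diff1)
  then show ?thesis by (simp add: sum.swap[of h])
qed

text \<open>The geometric series of ratio \<open>x / y\<close>, multiplied out to hold in any
  commutative ring. Passing from \<open>a\<close> to \<open>Suc a\<close> multiplies the old terms
  by \<open>y\<close> and adds \<open>x ^ a * y\<close>.\<close>

lemma mixed_geometric_sum:
  fixes x y :: "'r::comm_ring_1"
  assumes "0 < a"
  shows "(y - x) * (\<Sum>l=1..<a. x ^ l * y ^ (a - l)) = x * y ^ a - y * x ^ a"
  using assms
proof (induction a rule: nat_induct_non_zero)
  case (Suc a)
  have "(\<Sum>l=1..<a. x ^ l * y ^ (Suc a - l)) = y * (\<Sum>l=1..<a. x ^ l * y ^ (a - l))"
    unfolding sum_distrib_left by (intro sum.cong) (auto simp: Suc_diff_le)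
  then have "(\<Sum>l=1..<Suc a. x ^ l * y ^ (Suc a - l)) = y * (\<Sum>l=1..<a. x ^ l * y ^ (a - l)) + x ^ a * y"
    using Suc by simp
  then have "(y - x) * (\<Sum>l=1..<Suc a. x ^ l * y ^ (Suc a - l)) =
      y * ((y - x) * (\<Sum>l=1..<a. x ^ l * y ^ (a - l))) + (y - x) * x ^ a * y"
    by (simp add: algebra_simps)
  then show ?case
    unfolding Suc.IH by (simp add: algebra_simps)
qed simp

lemma geometric_sum_from_1:
  fixes x :: "'r::comm_ring_1"
  assumes "0 < a"
  shows "(1 - x) * (\<Sum>l=1..<a. x ^ l) = x - x ^ a"
  using assms
proof (induction a rule: nat_induct_non_zero)
  case (Suc a)
  have "(1 - x) * (\<Sum>l=1..<Suc a. x ^ l) = (1 - x) * (\<Sum>l=1..<a. x ^ l) + (1 - x) * x ^ a"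
    using Suc.hyps by (simp add: distrib_left)
  then show ?case unfolding Suc.IH by (simp add: algebra_simps)
qed simp

section \<open>Euler operators in the two variables\<close>

lemma pderiv_sum: "pderiv (sum h I) = (\<Sum>i\<in>I. pderiv (h i))"
  by (induction I rule: infinite_finite_induct) (simp_all add: pderiv_add)

text \<open>\<open>dX\<close> and \<open>dY\<close> are the Euler operators of the two variables.
  \<open>X\<close> is the series variable, while \<open>Y\<close> lives in the polynomial
  coefficients, so that a number can later be substituted for \<open>Y\<close>.\<close>

definition dX :: "real poly fps \<Rightarrow> real poly fps" where
  "dX F = fps_X * fps_deriv F"

definition dY :: "real poly fps \<Rightarrow> real poly fps" where
  "dY F = Abs_fps (\<lambda>j. [:0, 1:] * pderiv (fps_nth F j))"

abbreviation X :: "real poly fps" where "X \<equiv> fps_X"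

definition Y :: "real poly fps" where "Y = fps_const [:0, 1:]"

text \<open>This is \<open>1 / (1 - X)\<close>, given by its coefficients because these do not form
  a field.\<close>

definition geo :: "real poly fps" where "geo = Abs_fps (\<lambda>_. 1)"

lemma dX_nth: "fps_nth (dX F) j = of_nat j * fps_nth F j"
  by (cases j) (auto simp: dX_def)

lemma dY_nth: "fps_nth (dY F) j = [:0, 1:] * pderiv (fps_nth F j)"
  by (simp add: dY_def)

lemma dX_mult: "dX (F * G) = dX F * G + F * dX G"
  by (simp add: dX_def algebra_simps)

lemma dY_mult: "dY (F * G) = dY F * G + F * dY G"
proof (rule fps_ext)
  fix n
  define y where "y = [:0, 1 :: real:]"
  show "fps_nth (dY (F * G)) n = fps_nth (dY F * G + F * dY G) n"
    unfolding dY_nth fps_mult_nth fps_add_nth pderiv_sum pderiv_mult y_def[symmetric]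
    by (simp add: sum.distrib[symmetric] sum_distrib_left algebra_simps)
qed

lemma dX_add: "dX (F + G) = dX F + dX G" and dX_diff: "dX (F - G) = dX F - dX G"
  by (simp_all add: dX_def algebra_simps)

lemma dY_add: "dY (F + G) = dY F + dY G" and dY_diff: "dY (F - G) = dY F - dY G"
  by (rule fps_ext, simp add: dY_nth pderiv_add pderiv_diff algebra_simps)+

lemma dX_sum: "dX (sum h I) = (\<Sum>i\<in>I. dX (h i))"
  by (induction I rule: infinite_finite_induct) (simp_all add: dX_add, simp_all add: dX_def)

lemma dX_1: "dX 1 = 0" and dY_1: "dY 1 = 0"
  by (simp add: dX_def) (rule fps_ext, simp add: dY_nth)

lemma dX_Y: "dX Y = 0" and dY_X: "dY X = 0" and dX_X: "dX X = X" and dY_Y: "dY Y = Y"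
     apply (simp add: dX_def Y_def)
    apply (rule fps_ext, simp add: dY_nth)
   apply (simp add: dX_def)
  apply (rule fps_ext, simp add: dY_nth Y_def pderiv_pCons)
  done

lemma dX_X_power: "dX (X ^ k) = of_nat k * X ^ k" and dX_Y_power: "dX (Y ^ k) = 0"
  and dY_Y_power: "dY (Y ^ k) = of_nat k * Y ^ k" and dY_X_power: "dY (X ^ k) = 0"
  by (induction k; simp add: dX_1 dY_1 dX_mult dY_mult dX_Y dY_X dX_X dY_Y algebra_simps)+

lemma dX_of_nat: "dX (of_nat k) = 0"
  by (simp add: dX_def)

lemma geo_mult: "(1 - X) * geo = 1"
  by (rule fps_ext) (auto simp: geo_def algebra_simps fps_X_mult_nth)

lemma dX_geo: "dX geo = X * geo ^ 2"
proof -
  have "dX ((1 - X) * geo) = 0" by (simp add: geo_mult dX_1)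
  then have "(1 - X) * dX geo = X * geo"
    by (simp add: dX_mult dX_diff dX_1 dX_X algebra_simps)
  then have "(1 - X) * geo * dX geo = X * geo ^ 2"
    by (simp add: power2_eq_square mult_ac)
  then show ?thesis by (simp add: geo_mult)
qed

lemma dY_geo: "dY geo = 0"
  by (rule fps_ext) (simp add: dY_nth geo_def)

text \<open>Equal to \<open>1 - (1 - X ^ k) * (1 - Y ^ k)\<close>. At \<open>Y = 1\<close> it is 1,
  so the product over all cycles is trivial there, while its first derivative in \<open>Y\<close> at
  that point counts points by cycle length.\<close>

definition cyc_weight :: "nat \<Rightarrow> real poly fps" where
  "cyc_weight k = X ^ k + Y ^ k - X ^ k * Y ^ k"

lemma dX_cyc_weight: "dX (cyc_weight k) = of_nat k * (X ^ k * (1 - Y ^ k))"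
  and dY_cyc_weight: "dY (cyc_weight k) = of_nat k * (Y ^ k * (1 - X ^ k))"
  by (simp_all add: cyc_weight_def dX_add dX_diff dX_mult dX_X_power dX_Y_power dY_add dY_diff dY_mult
      dY_X_power dY_Y_power algebra_simps)

text \<open>Multiplied by \<open>k * l\<close>, the right-hand side is minus the symmetrised product
  of \<open>dX\<close> of one weight and \<open>dY\<close> of the other. This is why merging cycles
  acts as a mixed second derivative.\<close>

lemma cyc_weight_add:
  "cyc_weight (k + l) - cyc_weight k * cyc_weight l =
    - (X ^ k * (1 - Y ^ k) * (Y ^ l * (1 - X ^ l)) + X ^ l * (1 - Y ^ l) * (Y ^ k * (1 - X ^ k)))"
  by (simp add: cyc_weight_def power_add algebra_simps)

text \<open>
  What remains of the split terms of the cut-and-join rule after the merge terms have been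
  rewritten as \<open>- (X \<partial>\<^sub>X) (Y \<partial>\<^sub>Y) g\<close>.
\<close>

definition split_rest :: "nat \<Rightarrow> real poly fps" where
  "split_rest a = (\<Sum>l=1..<a. X ^ l * (1 - Y ^ l) * (Y ^ (a - l) * (1 - X ^ (a - l)))) - of_nat a * X ^ a * Y ^ a"

text \<open>\<open>P\<close> and \<open>Q\<close> stand for \<open>x ^ a\<close> and
  \<open>y ^ a\<close>, and \<open>Gx\<close>, \<open>Gy\<close>, \<open>K\<close> for the three
  geometric sums. Only the closed forms of the sums matter, so the powers can be treated as
  independent letters.\<close>

lemma split_rest_poly_identity:
  fixes x y P Q Gx Gy K :: "'r::comm_ring_1"
  assumes "(1 - x) * Gx = x - P" "(1 - y) * Gy = y - Q" "(y - x) * K = x * Q - y * P"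
  shows "(1 - y) * (1 - x) * ((y - x) * (K - Q * Gx - P * Gy - P * Q)) =
    (1 - y)\<^sup>2 * x * (Q * (1 - P)) - (1 - x)\<^sup>2 * y * (P * (1 - Q))"
proof -
  have "(1 - y) * (1 - x) * ((y - x) * (K - Q * Gx - P * Gy - P * Q)) =
    (1 - y) * (1 - x) * ((y - x) * K) - (y - x) * (1 - y) * Q * ((1 - x) * Gx)
      - (y - x) * (1 - x) * P * ((1 - y) * Gy) - (1 - x) * (1 - y) * (y - x) * P * Q"
    by (simp add: algebra_simps)
  then show ?thesis
    unfolding assms by (simp add: algebra_simps power2_eq_square)
qed

lemma split_rest_closed:
  assumes "0 < a"
  shows "split_rest a = (\<Sum>l=1..<a. X ^ l * Y ^ (a - l)) - Y ^ a * (\<Sum>l=1..<a. X ^ l)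
    - X ^ a * (\<Sum>l=1..<a. Y ^ l) - X ^ a * Y ^ a"
proof -
  have "X ^ l * (1 - Y ^ l) * (Y ^ (a - l) * (1 - X ^ (a - l))) =
      X ^ l * Y ^ (a - l) - Y ^ a * X ^ l - X ^ a * Y ^ (a - l) + X ^ a * Y ^ a"
    if "l \<in> {1..<a}" for l
  proof -
    have "X ^ l * X ^ (a - l) = X ^ a" "Y ^ l * Y ^ (a - l) = Y ^ a"
      using that by (subst power_add[symmetric], simp)+
    moreover have "u * (1 - y) * (z * (1 - v)) = u * z - (y * z) * u - (u * v) * z + (u * v) * (y * z)"
      for u v y z :: "real poly fps"
      by (simp add: algebra_simps)
    ultimately show ?thesis by (simp only:)
  qed
  then have "(\<Sum>l=1..<a. X ^ l * (1 - Y ^ l) * (Y ^ (a - l) * (1 - X ^ (a - l)))) =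
    (\<Sum>l=1..<a. X ^ l * Y ^ (a - l) - Y ^ a * X ^ l - X ^ a * Y ^ (a - l) + X ^ a * Y ^ a)"
    by (rule sum.cong[OF refl])
  also have "\<dots> = (\<Sum>l=1..<a. X ^ l * Y ^ (a - l)) - Y ^ a * (\<Sum>l=1..<a. X ^ l)
    - X ^ a * (\<Sum>l=1..<a. Y ^ (a - l)) + of_nat (a - 1) * (X ^ a * Y ^ a)"
    by (simp add: sum.distrib sum_subtractf sum_distrib_left)
  also have "(\<Sum>l=1..<a. Y ^ (a - l)) = (\<Sum>l=1..<a. Y ^ l)"
    by (rule sum.reindex_bij_witness[of _ "\<lambda>l. a - l" "\<lambda>l. a - l"]) auto
  \<comment> \<open>The sum yields \<open>a - 1\<close> copies of \<open>X ^ a * Y ^ a\<close>, and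
    \<open>split_rest\<close> subtracts \<open>a\<close> of them; one negative copy remains.\<close>
  finally show ?thesis
    using assms by (simp add: split_rest_def of_nat_diff algebra_simps)
qed

lemma geo_factor_mult: "(1 - X) * (1 - (1 - Y) * geo) = Y - X"
proof -
  have "(1 - X) * (1 - (1 - Y) * geo) = (1 - X) - (1 - Y) * ((1 - X) * geo)"
    by (simp add: algebra_simps)
  then show ?thesis by (simp add: geo_mult)
qed

text \<open>After multiplication by \<open>(1 - X)^2\<close> both occurrences of \<open>geo\<close>
  disappear and the polynomial identity applies; the factor is then cancelled. Up to the factor
  \<open>a\<close>, the right-hand side is a combination of \<open>dX\<close> and \<open>dY\<close>
  of a single weight, so the remaining split terms act as a first-order operator.\<close>

lemma split_rest_identity:
  assumes "0 < a"
  shows "(1 - Y) * (1 - (1 - Y) * geo) * split_rest a =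
    (1 - Y)\<^sup>2 * X * geo\<^sup>2 * (Y ^ a * (1 - X ^ a)) - Y * (X ^ a * (1 - Y ^ a))" (is "?l = ?r")
proof -
  have "(1 - X)\<^sup>2 * ?l = (1 - Y) * (1 - X) * (((1 - X) * (1 - (1 - Y) * geo)) * split_rest a)"
    by (simp only: power2_eq_square mult_ac)
  also have "\<dots> = (1 - Y)\<^sup>2 * X * (Y ^ a * (1 - X ^ a)) - (1 - X)\<^sup>2 * Y * (X ^ a * (1 - Y ^ a))"
    unfolding geo_factor_mult split_rest_closed[OF assms]
    by (intro split_rest_poly_identity geometric_sum_from_1 mixed_geometric_sum assms)
  also have "\<dots> = (1 - Y)\<^sup>2 * X * ((1 - X) * geo)\<^sup>2 * (Y ^ a * (1 - X ^ a)) - (1 - X)\<^sup>2 * Y * (X ^ a * (1 - Y ^ a))"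
    by (simp add: geo_mult)
  also have "\<dots> = (1 - X)\<^sup>2 * ?r"
    unfolding right_diff_distrib power_mult_distrib by (simp only: mult_ac)
  finally have "(1 - X)\<^sup>2 * ?l = (1 - X)\<^sup>2 * ?r" .
  moreover have "(1 - X)\<^sup>2 \<noteq> 0"
    using geo_mult by (metis mult_zero_left zero_neq_one zero_eq_power2)
  ultimately show ?thesis by simp
qed

section \<open>The transport equation\<close>

abbreviation cyc_gf :: "nat set \<Rightarrow> (nat \<Rightarrow> nat) \<Rightarrow> real poly fps" where
  "cyc_gf S f \<equiv> cycle_prod cyc_weight S f"

text \<open>Over ordered pairs, hence twice the generator, see
  \<open>pair_sum_gen_op\<close>.\<close>

abbreviation pair_sum :: "nat set \<Rightarrow> ((nat \<Rightarrow> nat) \<Rightarrow> 'b) \<Rightarrow> (nat \<Rightarrow> nat) \<Rightarrow> 'b::ab_group_add" where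
  "pair_sum S F f \<equiv> (\<Sum>i\<in>S. \<Sum>j\<in>S - {i}. F (Transposition.transpose i j \<circ> f) - F f)"

context
  fixes S :: "nat set" and f :: "nat \<Rightarrow> nat"
  assumes S: "finite S" and f: "f permutes S"
begin

lemma dX_cyc_gf:
  "dX (cyc_gf S f) = (\<Sum>A\<in>cycles S f. of_nat (card A) * (X ^ card A * (1 - Y ^ card A)) *
     (\<Prod>C\<in>cycles S f - {A}. cyc_weight (card C)))"
  unfolding cycle_prod_def
  by (subst derivation_prod[of dX]) (simp_all add: dX_mult dX_cyc_weight finite_cycles[OF S f])

lemma dY_cyc_gf:
  "dY (cyc_gf S f) = (\<Sum>A\<in>cycles S f. of_nat (card A) * (Y ^ card A * (1 - X ^ card A)) *
     (\<Prod>C\<in>cycles S f - {A}. cyc_weight (card C)))"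
  unfolding cycle_prod_def
  by (subst derivation_prod[of dY]) (simp_all add: dY_mult dY_cyc_weight finite_cycles[OF S f])

text \<open>The double sum arises when the two operators hit different cycles, the single sum when
  both hit the same one.\<close>

lemma dX_dY_cyc_gf:
  "dX (dY (cyc_gf S f)) =
     (\<Sum>A\<in>cycles S f. \<Sum>B\<in>cycles S f - {A}. of_nat (card A * card B) *
       (Y ^ card A * (1 - X ^ card A) * (X ^ card B * (1 - Y ^ card B))) *
       (\<Prod>C\<in>cycles S f - {A, B}. cyc_weight (card C)))
     - (\<Sum>A\<in>cycles S f. of_nat (card A) * (of_nat (card A) * X ^ card A * Y ^ card A) *
       (\<Prod>C\<in>cycles S f - {A}. cyc_weight (card C)))"
proof -
  let ?O = "cycles S f"
  have prod: "dX (\<Prod>C\<in>?O - {A}. cyc_weight (card C)) = (\<Sum>B\<in>?O - {A}.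
      of_nat (card B) * (X ^ card B * (1 - Y ^ card B)) * (\<Prod>C\<in>?O - {A, B}. cyc_weight (card C)))" for A
  proof -
    have "?O - {A} - {B} = ?O - {A, B}" for B by auto
    then show ?thesis
      by (subst derivation_prod[of dX]) (simp_all add: dX_mult dX_cyc_weight finite_cycles[OF S f])
  qed
  have "dX (of_nat a * (Y ^ a * (1 - X ^ a))) = - (of_nat a * (of_nat a * X ^ a * Y ^ a))" for a
    by (simp add: dX_mult dX_of_nat dX_diff dX_1 dX_X_power dX_Y_power algebra_simps)
  then have "dX (dY (cyc_gf S f)) = (\<Sum>A\<in>?O. - (of_nat (card A) * (of_nat (card A) * X ^ card A * Y ^ card A))
      * (\<Prod>C\<in>?O - {A}. cyc_weight (card C)) + of_nat (card A) * (Y ^ card A * (1 - X ^ card A)) *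
      (\<Sum>B\<in>?O - {A}. of_nat (card B) * (X ^ card B * (1 - Y ^ card B)) * (\<Prod>C\<in>?O - {A, B}. cyc_weight (card C))))"
    unfolding dY_cyc_gf dX_sum by (intro sum.cong refl) (simp only: dX_mult[of "_ * (_ * _)"] prod)
  also have "\<dots> = (\<Sum>A\<in>?O. (\<Sum>B\<in>?O - {A}. of_nat (card A * card B) *
       (Y ^ card A * (1 - X ^ card A) * (X ^ card B * (1 - Y ^ card B))) *
       (\<Prod>C\<in>?O - {A, B}. cyc_weight (card C))) - of_nat (card A) * (of_nat (card A) * X ^ card A * Y ^ card A) *
       (\<Prod>C\<in>?O - {A}. cyc_weight (card C)))"
    by (intro sum.cong refl) (simp add: sum_distrib_left mult_ac)
  finally show ?thesis by (simp add: sum_subtractf)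
qed

text \<open>By \<open>cyc_weight_add\<close> the merge terms give minus twice the off-diagonal part
  of the mixed derivative. The split terms supply the diagonal part, up to
  \<open>split_rest\<close>.\<close>

lemma pair_sum_cyc_gf:
  "pair_sum S (cyc_gf S) f = 2 * ((\<Sum>A\<in>cycles S f. of_nat (card A) * split_rest (card A) *
       (\<Prod>C\<in>cycles S f - {A}. cyc_weight (card C))) - dX (dY (cyc_gf S f)))"
proof -
  let ?O = "cycles S f"
  define h where "h A B = of_nat (card A * card B) *
       (Y ^ card A * (1 - X ^ card A) * (X ^ card B * (1 - Y ^ card B))) *
       (\<Prod>C\<in>?O - {A, B}. cyc_weight (card C))" for A B
  have "(\<Sum>A\<in>?O. \<Sum>B\<in>?O - {A}. of_nat (card A * card B) *
       (cyc_weight (card A + card B) - cyc_weight (card A) * cyc_weight (card B)) * (\<Prod>C\<in>?O - {A, B}. cyc_weight (card C))) =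
     (\<Sum>A\<in>?O. \<Sum>B\<in>?O - {A}. - (h A B + h B A))"
    unfolding cyc_weight_add h_def
    by (intro sum.cong refl) (simp add: insert_commute algebra_simps)
  also have "\<dots> = - ((\<Sum>A\<in>?O. \<Sum>B\<in>?O - {A}. h A B) + (\<Sum>A\<in>?O. \<Sum>B\<in>?O - {A}. h B A))"
    by (simp only: sum_negf sum.distrib)
  also have "\<dots> = - (2 * (\<Sum>A\<in>?O. \<Sum>B\<in>?O - {A}. h A B))"
    using sum_off_diagonal_swap[OF finite_cycles[OF S f], of h] by simp
  finally have merge: "(\<Sum>A\<in>?O. \<Sum>B\<in>?O - {A}. of_nat (card A * card B) *
       (cyc_weight (card A + card B) - cyc_weight (card A) * cyc_weight (card B)) * (\<Prod>C\<in>?O - {A, B}. cyc_weight (card C))) =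
     - (2 * (\<Sum>A\<in>?O. \<Sum>B\<in>?O - {A}. h A B))" .
  have split: "(\<Sum>l=1..<a. cyc_weight l * cyc_weight (a - l) - cyc_weight a) = 2 * (split_rest a + of_nat a * X ^ a * Y ^ a)" for a
  proof -
    define u where "u l = X ^ l * (1 - Y ^ l) * (Y ^ (a - l) * (1 - X ^ (a - l)))" for l
    \<comment> \<open>The two halves of \<open>cyc_weight_add\<close> are exchanged by
      \<open>l\<close> to \<open>a - l\<close>, so they have equal sums.\<close>
    have "(\<Sum>l=1..<a. cyc_weight l * cyc_weight (a - l) - cyc_weight a) = (\<Sum>l=1..<a. u l + u (a - l))"
    proof (intro sum.cong refl)
      fix l assume "l \<in> {1..<a}"
      then show "cyc_weight l * cyc_weight (a - l) - cyc_weight a = u l + u (a - l)"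
        using cyc_weight_add[of l "a - l"] by (auto simp: u_def algebra_simps)
    qed
    also have "\<dots> = (\<Sum>l=1..<a. u l) + (\<Sum>l=1..<a. u (a - l))" by (rule sum.distrib)
    also have "(\<Sum>l=1..<a. u (a - l)) = (\<Sum>l=1..<a. u l)"
      by (rule sum.reindex_bij_witness[of _ "\<lambda>l. a - l" "\<lambda>l. a - l"]) auto
    finally show ?thesis by (simp add: split_rest_def u_def)
  qed
  have "pair_sum S (cyc_gf S) f = - (2 * (\<Sum>A\<in>?O. \<Sum>B\<in>?O - {A}. h A B)) +
     (\<Sum>A\<in>?O. of_nat (card A) * (2 * (split_rest (card A) + of_nat (card A) * X ^ card A * Y ^ card A)) *
       (\<Prod>C\<in>?O - {A}. cyc_weight (card C)))"
    unfolding cut_join[OF S f] merge split ..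
  also have "(\<Sum>A\<in>?O. of_nat (card A) * (2 * (split_rest (card A) + of_nat (card A) * X ^ card A * Y ^ card A)) *
       (\<Prod>C\<in>?O - {A}. cyc_weight (card C))) = 2 * (\<Sum>A\<in>?O. of_nat (card A) * split_rest (card A) *
       (\<Prod>C\<in>?O - {A}. cyc_weight (card C))) + 2 * (\<Sum>A\<in>?O. of_nat (card A) *
       (of_nat (card A) * X ^ card A * Y ^ card A) * (\<Prod>C\<in>?O - {A}. cyc_weight (card C)))"
    unfolding sum_distrib_left sum.distrib[symmetric] by (intro sum.cong refl) (simp add: algebra_simps)
  finally have "pair_sum S (cyc_gf S) f = - (2 * (\<Sum>A\<in>?O. \<Sum>B\<in>?O - {A}. h A B)) + \<dots>" .
  moreover have "- (2 * a) + (2 * b + 2 * d) = 2 * (b - (a - d))" for a b d :: "real poly fps"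
    by (simp add: algebra_simps)
  ultimately show ?thesis
    unfolding dX_dY_cyc_gf h_def by (simp only:)
qed

text \<open>
  Here \<open>c = (1 - Y) \<Delta>\<close>: the equation is multiplied by \<open>(1 - Y)\<^sup>2\<close> to stay among polynomials in \<open>Y\<close>.
\<close>

theorem pair_sum_transport:
  defines "c \<equiv> 1 - (1 - Y) * geo" and "g \<equiv> cyc_gf S f"
  shows "(1 - Y) * (c * pair_sum S (cyc_gf S) f) = - 2 * dX ((1 - Y) * dY (c * g) + Y * (c * g))"
proof -
  have dYc: "dY c = Y * geo" by (simp add: c_def dY_diff dY_mult dY_1 dY_Y dY_geo)
  have dXc: "dX c = - ((1 - Y) * (X * geo\<^sup>2))"
    by (simp add: c_def dX_diff dX_mult dX_1 dX_Y dX_geo)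
  \<comment> \<open>Since \<open>c = (1 - Y) \<Delta>\<close>, this expression is
    \<open>(1 - Y)^2\<close> times \<open>dY\<close> of \<open>\<Delta> g\<close>.\<close>
  have "(1 - Y) * dY (c * g) + Y * (c * g) = Y * ((1 - Y) * geo + c) * g + (1 - Y) * c * dY g"
    unfolding dY_mult dYc by (simp only: distrib_left distrib_right mult_ac add_ac)
  also have "(1 - Y) * geo + c = 1" by (simp add: c_def)
  finally have inner: "(1 - Y) * dY (c * g) + Y * (c * g) = Y * g + (1 - Y) * c * dY g" by simp
  have R: "dX ((1 - Y) * dY (c * g) + Y * (c * g)) =
      Y * dX g - (1 - Y)\<^sup>2 * X * geo\<^sup>2 * dY g + (1 - Y) * c * dX (dY g)"
    unfolding inner by (simp add: dX_add dX_mult dX_diff dX_1 dX_Y dXc power2_eq_square algebra_simps)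
  define E where "E = (\<Sum>A\<in>cycles S f. of_nat (card A) * split_rest (card A) * (\<Prod>C\<in>cycles S f - {A}. cyc_weight (card C)))"
  have "(1 - Y) * c * E =
      (\<Sum>A\<in>cycles S f. of_nat (card A) * ((1 - Y) * c * split_rest (card A)) * (\<Prod>C\<in>cycles S f - {A}. cyc_weight (card C)))"
    by (simp only: E_def sum_distrib_left mult_ac)
  also have "\<dots> = (\<Sum>A\<in>cycles S f. of_nat (card A) *
      ((1 - Y)\<^sup>2 * X * geo\<^sup>2 * (Y ^ card A * (1 - X ^ card A)) - Y * (X ^ card A * (1 - Y ^ card A)))
      * (\<Prod>C\<in>cycles S f - {A}. cyc_weight (card C)))"
    unfolding c_def using card_cycle_pos[OF S f] by (intro sum.cong refl) (simp only: split_rest_identity)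
  also have "\<dots> = (1 - Y)\<^sup>2 * X * geo\<^sup>2 * dY g - Y * dX g"
    unfolding g_def dX_cyc_gf dY_cyc_gf
    by (simp only: sum_distrib_left sum_subtractf right_diff_distrib left_diff_distrib mult_ac)
  finally have E: "(1 - Y) * c * E = (1 - Y)\<^sup>2 * X * geo\<^sup>2 * dY g - Y * dX g" .
  have P: "pair_sum S (cyc_gf S) f = 2 * (E - dX (dY g))"
    unfolding E_def g_def by (rule pair_sum_cyc_gf)
  have "(1 - Y) * (c * pair_sum S (cyc_gf S) f) = 2 * ((1 - Y) * c * E - (1 - Y) * c * dX (dY g))"
    unfolding P by (simp add: algebra_simps)
  \<comment> \<open>The first-order terms produced by differentiating \<open>c\<close> in
    \<open>R\<close> are exactly those coming from \<open>split_rest\<close> in \<open>E\<close>;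
    this is what the factor \<open>\<Delta>\<close> is chosen for.\<close>
  then show ?thesis unfolding R E by (simp add: algebra_simps)
qed

end

section \<open>Coefficients in X and their values at Y = 1\<close>

definition cyc_coeff :: "nat set \<Rightarrow> nat \<Rightarrow> (nat \<Rightarrow> nat) \<Rightarrow> real poly" where
  "cyc_coeff S j f = fps_nth (cyc_gf S f) j"

text \<open>
  The coefficient of \<open>X\<^sup>k\<close> in \<open>\<Delta> g\<close>. The polynomial division by \<open>1 - Y\<close> is exact only for \<open>k > 0\<close>.
\<close>

definition cyc_obs :: "nat set \<Rightarrow> nat \<Rightarrow> (nat \<Rightarrow> nat) \<Rightarrow> real poly" where
  "cyc_obs S k f = cyc_coeff S k f div [:1, -1:] - (\<Sum>j\<le>k. cyc_coeff S j f)"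

definition eval1 :: "real poly fps \<Rightarrow> real fps" where
  "eval1 F = Abs_fps (\<lambda>j. poly (fps_nth F j) 1)"

lemma eval1_nth: "fps_nth (eval1 F) j = poly (fps_nth F j) 1"
  by (simp add: eval1_def)

lemma eval1_mult: "eval1 (F * G) = eval1 F * eval1 G"
  by (rule fps_ext) (simp add: eval1_nth fps_mult_nth poly_sum)

lemma eval1_add: "eval1 (F + G) = eval1 F + eval1 G" and eval1_diff: "eval1 (F - G) = eval1 F - eval1 G"
  by (rule fps_ext, simp add: eval1_nth)+

lemma eval1_1: "eval1 1 = 1"
  by (rule fps_ext) (simp add: eval1_nth)

lemma eval1_0: "eval1 0 = 0"
  by (rule fps_ext) (simp add: eval1_nth)

lemma eval1_sum: "eval1 (sum h I) = (\<Sum>i\<in>I. eval1 (h i))"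
  by (induction I rule: infinite_finite_induct) (simp_all add: eval1_0 eval1_add)

lemma eval1_prod: "eval1 (prod h I) = (\<Prod>i\<in>I. eval1 (h i))"
  by (induction I rule: infinite_finite_induct) (simp_all add: eval1_1 eval1_mult)

lemma eval1_of_nat: "eval1 (of_nat k) = of_nat k"
  by (induction k) (simp_all add: eval1_0 eval1_1 eval1_add)

lemma eval1_X_power: "eval1 (X ^ k) = fps_X ^ k"
  by (rule fps_ext) (simp add: eval1_nth)

lemma eval1_Y_power: "eval1 (Y ^ k) = 1"
proof -
  have "eval1 Y = 1" by (rule fps_ext) (simp add: eval1_nth Y_def)
  then show ?thesis by (induction k) (simp_all add: eval1_1 eval1_mult)
qed

lemma eval1_cyc_weight: "eval1 (cyc_weight k) = 1"
  by (simp add: cyc_weight_def eval1_add eval1_diff eval1_mult eval1_X_power eval1_Y_power)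

lemma eval1_cyc_gf: "eval1 (cyc_gf S f) = 1"
  by (simp add: cycle_prod_def eval1_prod eval1_cyc_weight)

lemma poly_cyc_coeff_1: "poly (cyc_coeff S j f) 1 = (if j = 0 then 1 else 0)"
  using arg_cong[OF eval1_cyc_gf[of S f], of "\<lambda>F. fps_nth F j"] by (simp add: eval1_nth cyc_coeff_def)

lemma Y_alt: "1 - Y = fps_const [:1, -1:]"
proof -
  have "1 - Y = fps_const (1 - [:0, 1:])"
    unfolding Y_def fps_const_1_eq_1[symmetric] fps_const_sub ..
  then show ?thesis by (simp add: one_pCons)
qed

text \<open>The generating function is 1 at \<open>Y = 1\<close>, so its coefficients of positive
  index vanish there and \<open>1 - Y\<close> divides them.\<close>

lemma cyc_coeff_div:
  assumes "0 < k"
  shows "[:1, -1:] * (cyc_coeff S k f div [:1, -1:]) = cyc_coeff S k f"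
proof -
  have "[:-1, 1:] dvd cyc_coeff S k f"
    using poly_cyc_coeff_1[of S k f] assms by (simp add: poly_eq_0_iff_dvd)
  moreover have "[:1, -1 :: real:] = - [:-1, 1:]" by simp
  ultimately have "[:1, -1:] dvd cyc_coeff S k f"
    by (metis minus_dvd_iff)
  then show ?thesis by (rule dvd_mult_div_cancel)
qed

lemma geo_factor_nth:
  "fps_nth ((1 - (1 - Y) * geo) * F) k = fps_nth F k - [:1, -1:] * (\<Sum>j\<le>k. fps_nth F j)"
proof -
  have "fps_nth (geo * F) k = (\<Sum>j\<le>k. fps_nth F j)"
    unfolding mult.commute[of geo] by (simp add: fps_mult_nth geo_def atLeast0AtMost)
  then show ?thesis
    unfolding Y_alt by (simp add: left_diff_distrib mult.assoc del: mult_pCons_left)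
qed

lemma cyc_obs_mult:
  assumes "0 < k"
  shows "[:1, -1:] * cyc_obs S k f = fps_nth ((1 - (1 - Y) * geo) * cyc_gf S f) k"
  unfolding geo_factor_nth cyc_obs_def right_diff_distrib cyc_coeff_div[OF assms]
  by (simp only: cyc_coeff_def)

text \<open>The transport equation read off at \<open>X ^ k\<close>, where \<open>dX\<close> becomes
  the factor \<open>k\<close>. Both factors \<open>1 - Y\<close> are cancelled in the integral
  domain of polynomials.\<close>

theorem pair_sum_cyc_obs:
  assumes S: "finite S" and f: "f permutes S" and k: "0 < k"
  shows "pair_sum S (cyc_obs S k) f = - 2 * of_nat k * ([:0, 1:] * pderiv (cyc_obs S k f))"
proof -
  define c where "c = 1 - (1 - Y) * geo"
  define om y :: "real poly" where "om = [:1, -1:]" and "y = [:0, 1:]"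
  define v where "v = cyc_obs S k"
  have v: "fps_nth (c * cyc_gf S h) k = om * v h" for h
    using cyc_obs_mult[OF k] by (simp only: c_def om_def v_def)
  have "pderiv om = - 1" by (simp add: om_def pderiv_pCons one_pCons)
  then have dv: "pderiv (om * v f) = om * pderiv (v f) - v f"
    by (simp add: pderiv_mult)
  have "c * pair_sum S (cyc_gf S) f = pair_sum S (\<lambda>h. c * cyc_gf S h) f"
    by (simp only: sum_distrib_left right_diff_distrib)
  then have "fps_nth (c * pair_sum S (cyc_gf S) f) k = pair_sum S (\<lambda>h. om * v h) f"
    by (simp only: fps_sum_nth fps_sub_nth v)
  also have "\<dots> = om * pair_sum S v f"
    by (simp only: sum_distrib_left right_diff_distrib)
  finally have "fps_nth ((1 - Y) * (c * pair_sum S (cyc_gf S) f)) k = om * (om * pair_sum S v f)"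
    unfolding Y_alt om_def by simp
  moreover have "fps_nth (- 2 * dX ((1 - Y) * dY (c * cyc_gf S f) + Y * (c * cyc_gf S f))) k =
      - 2 * (of_nat k * (om * (y * pderiv (om * v f)) + y * (om * v f)))"
    unfolding Y_alt unfolding Y_def om_def[symmetric] y_def[symmetric] mult_minus_left fps_neg_nth mult_2 fps_add_nth dX_nth
      fps_mult_left_const_nth dY_nth v by simp
  ultimately have "om * (om * pair_sum S v f) =
      - 2 * (of_nat k * (om * (y * pderiv (om * v f)) + y * (om * v f)))"
    using pair_sum_transport[OF S f] by (simp only: c_def)
  \<comment> \<open>The term \<open>- v f\<close> created by differentiating \<open>1 - Y\<close>
    cancels against \<open>y * (om * v f)\<close>.\<close>
  also have "\<dots> = om * (om * (- 2 * of_nat k * (y * pderiv (v f))))"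
    unfolding dv by (simp add: algebra_simps)
  finally have "om * (om * pair_sum S v f) = om * (om * (- 2 * of_nat k * (y * pderiv (v f))))" .
  moreover have "om \<noteq> 0" by (simp add: om_def)
  ultimately have "pair_sum S v f = - 2 * of_nat k * (y * pderiv (v f))"
    by (simp only: mult_cancel_left simp_thms)
  then show ?thesis by (simp only: v_def y_def)
qed

text \<open>The quotient of a coefficient by \<open>1 - Y\<close> takes at 1 the value of minus its
  derivative, and \<open>dY_cyc_gf\<close> turns this into a count of points. The subtracted 1 is
  the sum of the coefficients at \<open>Y = 1\<close>, where only index 0 contributes.\<close>

lemma poly_cyc_obs_1:
  assumes S: "finite S" and f: "f permutes S" and k: "0 < k"
  shows "poly (cyc_obs S k f) 1 = real (card {x\<in>S. card (orbit f x) = k}) - 1"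
proof -
  let ?O = "cycles S f" and ?u = "cyc_coeff S k f div [:1, -1:]"
  have om: "pderiv [:1, -1 :: real:] = - 1" by (simp add: pderiv_pCons one_pCons)
  have "pderiv (cyc_coeff S k f) = pderiv ([:1, -1:] * ?u)"
    by (simp only: cyc_coeff_div[OF k])
  also have "\<dots> = [:1, -1:] * pderiv ?u - ?u"
    unfolding pderiv_mult om by simp
  finally have "poly ?u 1 = - poly ([:0, 1:] * pderiv (cyc_coeff S k f)) 1"
    by simp
  also have "\<dots> = - fps_nth (eval1 (dY (cyc_gf S f))) k"
    by (simp only: eval1_nth dY_nth cyc_coeff_def)
  also have "eval1 (dY (cyc_gf S f)) = (\<Sum>A\<in>?O. of_nat (card A) * (1 - fps_X ^ card A))"
    by (simp add: dY_cyc_gf[OF S f] eval1_sum eval1_mult eval1_of_nat eval1_diff eval1_1 eval1_X_power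
        eval1_Y_power eval1_prod eval1_cyc_weight)
  also have "- fps_nth \<dots> k = (\<Sum>A\<in>?O. real (card A) * of_bool (card A = k))"
    using k by (auto simp: fps_sum_nth sum_negf[symmetric] fps_of_nat[symmetric] intro!: sum.cong simp del: fps_of_nat)
  also have "\<dots> = (\<Sum>A\<in>?O. \<Sum>x\<in>A. of_bool (card (orbit f x) = k))"
    by (intro sum.cong refl) (simp add: cycles_orbit[OF S f])
  also have "\<dots> = (\<Sum>x\<in>S. of_bool (card (orbit f x) = k))"
    by (rule sum_cycles[OF S f, symmetric])
  also have "\<dots> = real (card {x\<in>S. card (orbit f x) = k})"
    using S by (simp add: sum.If_cases of_bool_def Int_def)
  finally have "poly ?u 1 = real (card {x\<in>S. card (orbit f x) = k})" .
  then show ?thesis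
    by (simp add: cyc_obs_def poly_sum poly_cyc_coeff_1)
qed

section \<open>The initial value at the identity permutation\<close>

lemma cyc_gf_id: "finite S \<Longrightarrow> cyc_gf S id = cyc_weight 1 ^ card S"
proof -
  assume "finite S"
  have orb: "orbit id x = {x}" for x :: nat by (simp add: orbit_eq_singleton_iff)
  have "cycles S id = (\<lambda>x. {x}) ` S" by (simp add: cycles_def orb)
  then show ?thesis
    by (simp add: cycle_prod_def prod.reindex)
qed

text \<open>A fixed point has weight \<open>(1 - Y) X + Y\<close>, so these are binomial
  probabilities with success probability \<open>1 - Y\<close>.\<close>

lemma cyc_coeff_id:
  assumes "finite S"
  shows "cyc_coeff S j id = of_nat (card S choose j) * [:1, -1:] ^ j * [:0, 1:] ^ (card S - j)"
proof -
  let ?n = "card S"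
  have "cyc_weight 1 = fps_const [:1, -1:] * X + Y"
    unfolding Y_alt[symmetric] by (simp add: cyc_weight_def algebra_simps)
  then have "cyc_gf S id = (\<Sum>i\<le>?n. of_nat (?n choose i) * (fps_const [:1, -1:] * X) ^ i * Y ^ (?n - i))"
    using assms by (simp add: cyc_gf_id binomial_ring)
  also have "\<dots> = (\<Sum>i\<le>?n. fps_const (of_nat (?n choose i) * [:1, -1:] ^ i * [:0, 1:] ^ (?n - i)) * X ^ i)"
  proof (intro sum.cong refl)
    fix i
    have "fps_const (of_nat (?n choose i) * [:1, -1:] ^ i * [:0, 1:] ^ (?n - i)) =
      of_nat (?n choose i) * fps_const [:1, -1 :: real:] ^ i * Y ^ (?n - i)"
      unfolding Y_def fps_const_mult[symmetric] fps_const_power[symmetric] fps_of_nat ..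
    then show "of_nat (?n choose i) * (fps_const [:1, -1:] * X) ^ i * Y ^ (?n - i) =
      fps_const (of_nat (?n choose i) * [:1, -1:] ^ i * [:0, 1:] ^ (?n - i)) * X ^ i"
      by (simp only: power_mult_distrib mult_ac)
  qed
  finally have eq: "cyc_gf S id = (\<Sum>i\<le>?n. fps_const (of_nat (?n choose i) * [:1, -1:] ^ i * [:0, 1:] ^ (?n - i)) * X ^ i)" .
  have "fps_nth (fps_const P * X ^ i) j = (if i = j then P else 0)" for P :: "real poly" and i
    by simp
  then have "cyc_coeff S j id = (\<Sum>i\<le>?n. if i = j then
      of_nat (?n choose i) * [:1, -1:] ^ i * [:0, 1:] ^ (?n - i) else 0)"
    unfolding cyc_coeff_def eq by (simp only: fps_sum_nth)
  then show ?thesis by (cases "j \<le> ?n") (simp_all only: sum.delta finite_atMost atMost_iff if_True if_False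
      binomial_eq_0 not_le of_nat_0 mult_zero_left)
qed

lemma poly_cyc_obs_id:
  assumes S: "finite S" and k: "0 < k"
  shows "poly (cyc_obs S k id) q = real (card S choose k) * (1 - q) ^ (k - 1) * q ^ (card S - k)
    - (\<Sum>j\<le>k. real (card S choose j) * (1 - q) ^ j * q ^ (card S - j))"
proof -
  have "cyc_coeff S k id = [:1, -1:] * (of_nat (card S choose k) * [:1, -1:] ^ (k - 1) * [:0, 1:] ^ (card S - k))"
    unfolding cyc_coeff_id[OF S] power_minus_mult[OF k, of "[:1, -1:]", symmetric] by (simp only: mult_ac)
  then have "cyc_coeff S k id div [:1, -1:] = of_nat (card S choose k) * [:1, -1:] ^ (k - 1) * [:0, 1:] ^ (card S - k)"
    by (simp only:) (rule nonzero_mult_div_cancel_left, simp)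
  then show ?thesis
    by (simp add: cyc_obs_def poly_sum cyc_coeff_id[OF S] poly_power)
qed

section \<open>The semigroup of the interchange process\<close>

declare One_nat_def [simp del]

definition transps :: "nat \<Rightarrow> (nat \<times> nat) set" where
  "transps n = {(i, j). 1 \<le> i \<and> i < j \<and> j \<le> n}"

abbreviation perms :: "nat \<Rightarrow> (nat \<Rightarrow> nat) set" where
  "perms n \<equiv> {\<pi>. \<pi> permutes {1..n}}"

text \<open>The codomain is general because the operator acts on real functions and on the
  polynomial-valued \<open>cyc_obs\<close>.\<close>

definition gen_op :: "nat \<Rightarrow> ((nat \<Rightarrow> nat) \<Rightarrow> 'b) \<Rightarrow> (nat \<Rightarrow> nat) \<Rightarrow> 'b::ab_group_add" where
  "gen_op n \<phi> \<pi> = (\<Sum>(i, j)\<in>transps n. \<phi> (Transposition.transpose i j \<circ> \<pi>) - \<phi> \<pi>)"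

definition heat :: "nat \<Rightarrow> real \<Rightarrow> ((nat \<Rightarrow> nat) \<Rightarrow> real) \<Rightarrow> (nat \<Rightarrow> nat) \<Rightarrow> real" where
  "heat n t \<phi> \<pi> = (\<Sum>m. (gen_op n ^^ m) \<phi> \<pi> / fact m * t ^ m)"

definition dirac_id :: "('a \<Rightarrow> 'a) \<Rightarrow> real" where
  "dirac_id \<pi> = of_bool (\<pi> = id)"

text \<open>These are the coefficients of \<open>exp (t Q)\<close>, as
  \<open>ga_exp_generator\<close> confirms.\<close>

definition law :: "nat \<Rightarrow> real \<Rightarrow> (nat \<Rightarrow> nat) \<Rightarrow> real" where
  "law n t = heat n t dirac_id"

definition mean :: "nat \<Rightarrow> real \<Rightarrow> ((nat \<Rightarrow> nat) \<Rightarrow> real) \<Rightarrow> real" where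
  "mean n t \<phi> = (\<Sum>\<pi>\<in>perms n. law n t \<pi> * \<phi> \<pi>)"

lemma finite_transps [simp]: "finite (transps n)"
  by (rule finite_subset[of _ "{1..n} \<times> {1..n}"]) (auto simp: transps_def)

lemma finite_perms [simp]: "finite (perms n)"
  by (simp add: finite_permutations)

lemma transpose_permutes:
  assumes "(i, j) \<in> transps n"
  shows "Transposition.transpose i j permutes {1..n}"
  using assms by (intro permutes_swap_id) (auto simp: transps_def)

lemma transpose_comp_permutes:
  assumes "(i, j) \<in> transps n" "\<pi> permutes {1..n}"
  shows "Transposition.transpose i j \<circ> \<pi> permutes {1..n}"
  using permutes_compose[OF assms(2) transpose_permutes[OF assms(1)]] .

lemma card_transps_le: "card (transps n) \<le> n\<^sup>2"
proof -
  have "card (transps n) \<le> card ({1..n} \<times> {1..n})"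
    by (intro card_mono) (auto simp: transps_def)
  then show ?thesis by (simp add: power2_eq_square)
qed

lemma gen_op_cong:
  assumes "\<And>\<pi>. \<pi> permutes {1..n} \<Longrightarrow> \<phi> \<pi> = \<psi> \<pi>" "\<pi> permutes {1..n}"
  shows "gen_op n \<phi> \<pi> = gen_op n \<psi> \<pi>"
  unfolding gen_op_def using assms transpose_comp_permutes by (intro sum.cong) auto

text \<open>Left multiplication by a transposition is an involution of the permutations, hence
  self-adjoint for the counting measure.\<close>

lemma gen_op_symmetric:
  fixes \<phi> \<psi> :: "(nat \<Rightarrow> nat) \<Rightarrow> real"
  shows "(\<Sum>\<pi>\<in>perms n. gen_op n \<phi> \<pi> * \<psi> \<pi>) = (\<Sum>\<pi>\<in>perms n. \<phi> \<pi> * gen_op n \<psi> \<pi>)"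
proof -
  have inv: "(\<Sum>\<pi>\<in>perms n. \<phi> (Transposition.transpose i j \<circ> \<pi>) * \<psi> \<pi>) =
      (\<Sum>\<pi>\<in>perms n. \<phi> \<pi> * \<psi> (Transposition.transpose i j \<circ> \<pi>))" if "(i, j) \<in> transps n" for i j
  proof (rule sum.reindex_bij_witness[of _ "\<lambda>\<pi>. Transposition.transpose i j \<circ> \<pi>" "\<lambda>\<pi>. Transposition.transpose i j \<circ> \<pi>"])
    fix \<pi> assume "\<pi> \<in> perms n"
    then show "Transposition.transpose i j \<circ> \<pi> \<in> perms n"
      using transpose_comp_permutes[OF that] by simp
  qed (auto simp: comp_assoc[symmetric] intro: transpose_comp_permutes[OF that])
  have "(\<Sum>\<pi>\<in>perms n. gen_op n \<phi> \<pi> * \<psi> \<pi>) = (\<Sum>(i, j)\<in>transps n.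
      (\<Sum>\<pi>\<in>perms n. \<phi> (Transposition.transpose i j \<circ> \<pi>) * \<psi> \<pi>) - (\<Sum>\<pi>\<in>perms n. \<phi> \<pi> * \<psi> \<pi>))"
    unfolding gen_op_def sum_distrib_right
    by (subst sum.swap) (simp add: case_prod_unfold sum_subtractf left_diff_distrib)
  also have "\<dots> = (\<Sum>(i, j)\<in>transps n.
      (\<Sum>\<pi>\<in>perms n. \<phi> \<pi> * \<psi> (Transposition.transpose i j \<circ> \<pi>)) - (\<Sum>\<pi>\<in>perms n. \<phi> \<pi> * \<psi> \<pi>))"
    using inv by (intro sum.cong) auto
  also have "\<dots> = (\<Sum>\<pi>\<in>perms n. \<phi> \<pi> * gen_op n \<psi> \<pi>)"
    unfolding gen_op_def sum_distrib_left
    by (subst sum.swap[of _ "transps n" "perms n"]) (simp add: case_prod_unfold sum_subtractf right_diff_distrib)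
  finally show ?thesis .
qed

lemma gen_op_power_symmetric:
  fixes \<phi> \<psi> :: "(nat \<Rightarrow> nat) \<Rightarrow> real"
  shows "(\<Sum>\<pi>\<in>perms n. (gen_op n ^^ m) \<phi> \<pi> * \<psi> \<pi>) = (\<Sum>\<pi>\<in>perms n. \<phi> \<pi> * (gen_op n ^^ m) \<psi> \<pi>)"
proof (induction m arbitrary: \<psi>)
  case (Suc m)
  have "(\<Sum>\<pi>\<in>perms n. (gen_op n ^^ Suc m) \<phi> \<pi> * \<psi> \<pi>) =
      (\<Sum>\<pi>\<in>perms n. (gen_op n ^^ m) \<phi> \<pi> * gen_op n \<psi> \<pi>)"
    using gen_op_symmetric[of n "(gen_op n ^^ m) \<phi>" \<psi>] by simp
  then show ?case
    using Suc by (simp add: funpow_swap1)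
qed simp

text \<open>The generator multiplies on the left, which commutes with multiplication on the
  right.\<close>

lemma gen_op_power_translate:
  "(gen_op n ^^ m) (\<lambda>\<pi>. \<phi> (\<pi> \<circ> \<rho>)) \<pi> = (gen_op n ^^ m) \<phi> (\<pi> \<circ> \<rho>)"
proof (induction m arbitrary: \<pi>)
  case (Suc m)
  then have "(gen_op n ^^ m) (\<lambda>\<pi>. \<phi> (\<pi> \<circ> \<rho>)) = (\<lambda>\<pi>. (gen_op n ^^ m) \<phi> (\<pi> \<circ> \<rho>))" by blast
  then show ?case
    by (simp only: funpow.simps o_apply[of "gen_op n"] gen_op_def[of n "(gen_op n ^^ m) _"] gen_op_def[of n "\<lambda>\<pi>. _ (\<pi> \<circ> \<rho>)"] comp_assoc)
qed simp

text \<open>Geometric growth of the powers makes the exponential series converge for every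
  time.\<close>

lemma gen_op_power_bound:
  fixes \<phi> :: "(nat \<Rightarrow> nat) \<Rightarrow> real"
  assumes "\<And>\<pi>. \<pi> permutes {1..n} \<Longrightarrow> \<bar>\<phi> \<pi>\<bar> \<le> B" "\<pi> permutes {1..n}"
  shows "\<bar>(gen_op n ^^ m) \<phi> \<pi>\<bar> \<le> (2 * real (card (transps n))) ^ m * B"
  using assms(2)
proof (induction m arbitrary: \<pi>)
  case 0
  then show ?case using assms(1) by simp
next
  case (Suc m)
  let ?c = "(2 * real (card (transps n))) ^ m * B"
  have "\<bar>(gen_op n ^^ Suc m) \<phi> \<pi>\<bar> \<le> (\<Sum>(i, j)\<in>transps n.
      \<bar>(gen_op n ^^ m) \<phi> (Transposition.transpose i j \<circ> \<pi>) - (gen_op n ^^ m) \<phi> \<pi>\<bar>)"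
    unfolding funpow.simps o_apply gen_op_def[of n "(gen_op n ^^ m) \<phi>"]
    by (rule order_trans[OF sum_abs]) (simp add: case_prod_unfold)
  also have "\<dots> \<le> (\<Sum>(i, j)\<in>transps n. 2 * ?c)"
  proof (intro sum_mono, clarify)
    fix i j assume ij: "(i, j) \<in> transps n"
    have "\<bar>(gen_op n ^^ m) \<phi> (Transposition.transpose i j \<circ> \<pi>)\<bar> \<le> ?c" "\<bar>(gen_op n ^^ m) \<phi> \<pi>\<bar> \<le> ?c"
      using Suc.IH transpose_comp_permutes[OF ij Suc.prems] Suc.prems by blast+
    then show "\<bar>(gen_op n ^^ m) \<phi> (Transposition.transpose i j \<circ> \<pi>) - (gen_op n ^^ m) \<phi> \<pi>\<bar> \<le> 2 * ?c"
      by linarith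
  qed
  also have "\<dots> = (2 * real (card (transps n))) ^ Suc m * B"
    by (simp add: case_prod_unfold)
  finally show ?case .
qed

lemma summable_heat:
  fixes \<phi> :: "(nat \<Rightarrow> nat) \<Rightarrow> real"
  assumes "\<pi> permutes {1..n}"
  shows "summable (\<lambda>m. (gen_op n ^^ m) \<phi> \<pi> / fact m * t ^ m)"
proof -
  define B where "B = (\<Sum>\<rho>\<in>perms n. \<bar>\<phi> \<rho>\<bar>)"
  have B: "\<bar>\<phi> \<rho>\<bar> \<le> B" if "\<rho> permutes {1..n}" for \<rho>
    unfolding B_def using that by (intro member_le_sum) auto
  let ?x = "2 * real (card (transps n)) * \<bar>t\<bar>"
  have "summable (\<lambda>m. B * (inverse (fact m) * ?x ^ m))"
    by (intro summable_mult summable_exp)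
  then show ?thesis
  proof (rule summable_comparison_test[rotated], intro exI allI impI)
    fix m :: nat
    have "norm ((gen_op n ^^ m) \<phi> \<pi> / fact m * t ^ m) = \<bar>(gen_op n ^^ m) \<phi> \<pi>\<bar> * (\<bar>t\<bar> ^ m / fact m)"
      by (simp add: abs_mult power_abs)
    also have "\<dots> \<le> ((2 * real (card (transps n))) ^ m * B) * (\<bar>t\<bar> ^ m / fact m)"
      using gen_op_power_bound[of n \<phi> B \<pi> m] B assms by (intro mult_right_mono) auto
    also have "\<dots> = B * (inverse (fact m) * ?x ^ m)"
      by (simp add: power_mult_distrib divide_inverse mult_ac)
    finally show "norm ((gen_op n ^^ m) \<phi> \<pi> / fact m * t ^ m) \<le> \<dots>" .
  qed
qed

lemma heat_gen_op:
  assumes "\<pi> permutes {1..n}"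
  shows "heat n t (gen_op n \<phi>) \<pi> = gen_op n (heat n t \<phi>) \<pi>"
proof -
  note s = summable_heat
  have "gen_op n (heat n t \<phi>) \<pi> = (\<Sum>(i, j)\<in>transps n. \<Sum>m.
      ((gen_op n ^^ m) \<phi> (Transposition.transpose i j \<circ> \<pi>) / fact m * t ^ m - (gen_op n ^^ m) \<phi> \<pi> / fact m * t ^ m))"
    unfolding gen_op_def[of n "heat n t \<phi>"] heat_def
    using s[OF assms] s[OF transpose_comp_permutes[OF _ assms]]
    by (intro sum.cong refl) (auto simp: suminf_diff)
  also have "\<dots> = (\<Sum>m. \<Sum>(i, j)\<in>transps n.
      ((gen_op n ^^ m) \<phi> (Transposition.transpose i j \<circ> \<pi>) / fact m * t ^ m - (gen_op n ^^ m) \<phi> \<pi> / fact m * t ^ m))"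
    unfolding case_prod_unfold using s[OF assms] s[OF transpose_comp_permutes[OF _ assms]]
    by (intro suminf_sum[symmetric] summable_diff) auto
  also have "\<dots> = (\<Sum>m. (gen_op n ^^ m) (gen_op n \<phi>) \<pi> / fact m * t ^ m)"
    unfolding funpow_swap1[symmetric] gen_op_def[of n "(gen_op n ^^ _) \<phi>"]
    by (simp add: case_prod_unfold sum_divide_distrib sum_distrib_right diff_divide_distrib left_diff_distrib)
  finally show ?thesis by (simp add: heat_def)
qed

text \<open>Termwise differentiation shifts the series by one application of the generator;
  \<open>heat_gen_op\<close> moves it outside the sum.\<close>

lemma heat_has_derivative:
  assumes "\<pi> permutes {1..n}"
  shows "((\<lambda>t. heat n t \<phi> \<pi>) has_real_derivative gen_op n (heat n t \<phi>) \<pi>) (at t)"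
proof -
  have "diffs (\<lambda>m. (gen_op n ^^ m) \<phi> \<pi> / fact m) = (\<lambda>m. (gen_op n ^^ m) (gen_op n \<phi>) \<pi> / fact m)"
    by (simp add: diffs_def fun_eq_iff funpow_swap1 field_simps del: of_nat_Suc)
  then show ?thesis
    using termdiffs_strong_converges_everywhere[OF summable_heat[OF assms], of \<phi> t]
    by (simp add: heat_def[of n _ \<phi>] heat_gen_op[OF assms, symmetric] heat_def[of n t "gen_op n \<phi>"]
        flip: heat_def)
qed

lemma heat_0: "heat n 0 \<phi> \<pi> = \<phi> \<pi>"
  unfolding heat_def by (subst suminf_finite[of "{0}"]) auto

text \<open>Symmetry moves the powers of the generator from the point mass onto the test
  function.\<close>

lemma mean_eq_heat: "mean n t \<phi> = heat n t \<phi> id"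
proof -
  have "mean n t \<phi> = (\<Sum>\<pi>\<in>perms n. \<Sum>m. (gen_op n ^^ m) dirac_id \<pi> / fact m * t ^ m * \<phi> \<pi>)"
    unfolding mean_def law_def heat_def
    by (intro sum.cong refl suminf_mult2 summable_heat) simp
  also have "\<dots> = (\<Sum>m. \<Sum>\<pi>\<in>perms n. (gen_op n ^^ m) dirac_id \<pi> / fact m * t ^ m * \<phi> \<pi>)"
    by (intro suminf_sum[symmetric] summable_mult2 summable_heat) simp
  also have "\<dots> = (\<Sum>m. (gen_op n ^^ m) \<phi> id / fact m * t ^ m)"
  proof (rule arg_cong[of _ _ suminf], rule ext)
    fix m
    have "(\<Sum>\<pi>\<in>perms n. (gen_op n ^^ m) dirac_id \<pi> / fact m * t ^ m * \<phi> \<pi>) =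
        (\<Sum>\<pi>\<in>perms n. (gen_op n ^^ m) dirac_id \<pi> * \<phi> \<pi>) / fact m * t ^ m"
      unfolding sum_divide_distrib sum_distrib_right by (intro sum.cong refl) (simp add: mult_ac)
    also have "(\<Sum>\<pi>\<in>perms n. (gen_op n ^^ m) dirac_id \<pi> * \<phi> \<pi>) = (gen_op n ^^ m) \<phi> id"
      unfolding gen_op_power_symmetric
      by (subst sum.remove[of _ id]) (auto simp: dirac_id_def permutes_id intro: sum.neutral)
    finally show "(\<Sum>\<pi>\<in>perms n. (gen_op n ^^ m) dirac_id \<pi> / fact m * t ^ m * \<phi> \<pi>) =
        (gen_op n ^^ m) \<phi> id / fact m * t ^ m" .
  qed
  finally show ?thesis by (simp add: heat_def)
qed

lemma heat_translate: "heat n t \<phi> \<rho> = mean n t (\<lambda>\<pi>. \<phi> (\<pi> \<circ> \<rho>))"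
  unfolding mean_eq_heat heat_def gen_op_power_translate by simp

lemma mean_eigenfunction:
  fixes \<phi> :: "(nat \<Rightarrow> nat) \<Rightarrow> real"
  assumes "\<And>\<pi>. \<pi> permutes {1..n} \<Longrightarrow> gen_op n \<phi> \<pi> = \<mu> * \<phi> \<pi>"
  shows "mean n t \<phi> = exp (\<mu> * t) * \<phi> id"
proof -
  have pow: "(gen_op n ^^ m) \<phi> \<pi> = \<mu> ^ m * \<phi> \<pi>" if "\<pi> permutes {1..n}" for m \<pi>
    using that
  proof (induction m arbitrary: \<pi>)
    case (Suc m)
    have "(gen_op n ^^ Suc m) \<phi> \<pi> = gen_op n (\<lambda>\<pi>. \<mu> ^ m * \<phi> \<pi>) \<pi>"
      unfolding funpow.simps o_apply using Suc by (intro gen_op_cong)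
    also have "\<dots> = \<mu> ^ m * gen_op n \<phi> \<pi>"
      by (simp add: gen_op_def sum_distrib_left case_prod_unfold right_diff_distrib)
    finally show ?case using assms[OF Suc.prems] by simp
  qed simp
  have "(\<lambda>m. \<phi> id * ((\<mu> * t) ^ m /\<^sub>R fact m)) sums (\<phi> id * exp (\<mu> * t))"
    by (intro sums_mult exp_converges)
  moreover have "(\<lambda>m. \<phi> id * ((\<mu> * t) ^ m /\<^sub>R fact m)) = (\<lambda>m. (gen_op n ^^ m) \<phi> id / fact m * t ^ m)"
    by (simp add: pow permutes_id fun_eq_iff power_mult_distrib divide_inverse mult_ac)
  ultimately show ?thesis
    unfolding mean_eq_heat heat_def by (simp add: sums_iff mult.commute)
qed

lemma mean_const: "mean n t (\<lambda>_. 1) = 1"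
  using mean_eigenfunction[of n "\<lambda>_. 1" 0 t] by (simp add: gen_op_def case_prod_unfold)

lemma law_0: "law n 0 \<pi> = of_bool (\<pi> = id)"
  by (simp add: law_def heat_0 dirac_id_def)

text \<open>
  The left-hand side is the increment over \<open>0 \<le> s \<le> t\<close> of the mean at time \<open>s\<close> of
  \<open>(heat n (t - s) \<phi>)\<^sup>2\<close>, whose derivative is the mean of a sum of squared differences along
  transpositions; the semigroup preserves the Lipschitz bound.
\<close>

theorem variance_bound:
  fixes \<phi> :: "(nat \<Rightarrow> nat) \<Rightarrow> real"
  assumes t: "0 \<le> t" and nonneg: "\<And>s \<pi>. 0 \<le> s \<Longrightarrow> \<pi> permutes {1..n} \<Longrightarrow> 0 \<le> law n s \<pi>"
    and Lip: "\<And>i j \<pi>. i \<in> {1..n} \<Longrightarrow> j \<in> {1..n} \<Longrightarrow> \<pi> permutes {1..n} \<Longrightarrow>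
      \<bar>\<phi> (Transposition.transpose i j \<circ> \<pi>) - \<phi> \<pi>\<bar> \<le> L"
  shows "mean n t (\<lambda>\<pi>. (\<phi> \<pi>)\<^sup>2) - (mean n t \<phi>)\<^sup>2 \<le> t * real (card (transps n)) * L\<^sup>2"
proof -
  define N where "N = real (card (transps n))"
  define h where "h s = heat n (t - s) \<phi>" for s
  define W where "W s = (\<Sum>\<rho>\<in>perms n. law n s \<rho> * (h s \<rho>)\<^sup>2)" for s
  have sum_law: "(\<Sum>\<rho>\<in>perms n. law n s \<rho>) = 1" for s
    using mean_const[of n s] by (simp add: mean_def)
  have h_Lip: "\<bar>h s (Transposition.transpose i j \<circ> \<rho>) - h s \<rho>\<bar> \<le> L"
    if s: "s \<le> t" and ij: "(i, j) \<in> transps n" and \<rho>: "\<rho> permutes {1..n}" for s i j \<rho>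
  proof -
    have "\<bar>\<phi> (\<pi> \<circ> (Transposition.transpose i j \<circ> \<rho>)) - \<phi> (\<pi> \<circ> \<rho>)\<bar> \<le> L" if \<pi>: "\<pi> permutes {1..n}" for \<pi>
    proof -
      \<comment> \<open>Conjugation by \<open>\<pi>\<close> turns the inner transposition into an
        outer one, to which the Lipschitz hypothesis applies.\<close>
      have "\<pi> \<circ> (Transposition.transpose i j \<circ> \<rho>) = Transposition.transpose (\<pi> i) (\<pi> j) \<circ> (\<pi> \<circ> \<rho>)"
        using permutes_inj[OF \<pi>] by (auto simp: fun_eq_iff Transposition.transpose_def inj_eq)
      moreover have "\<pi> i \<in> {1..n}" "\<pi> j \<in> {1..n}"
        using ij permutes_in_image[OF \<pi>] by (auto simp: transps_def)
      ultimately show ?thesis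
        using Lip[of "\<pi> i" "\<pi> j" "\<pi> \<circ> \<rho>"] permutes_compose[OF \<rho> \<pi>] by simp
    qed
    then have "law n (t - s) \<pi> * \<bar>\<phi> (\<pi> \<circ> (Transposition.transpose i j \<circ> \<rho>)) - \<phi> (\<pi> \<circ> \<rho>)\<bar> \<le> law n (t - s) \<pi> * L"
      if "\<pi> permutes {1..n}" for \<pi>
      using nonneg[of "t - s" \<pi>] s that by (intro mult_left_mono) auto
    then have "(\<Sum>\<pi>\<in>perms n. law n (t - s) \<pi> * \<bar>\<phi> (\<pi> \<circ> (Transposition.transpose i j \<circ> \<rho>)) - \<phi> (\<pi> \<circ> \<rho>)\<bar>)
        \<le> (\<Sum>\<pi>\<in>perms n. law n (t - s) \<pi> * L)"
      by (intro sum_mono) auto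
    also have "\<dots> = L" by (simp add: sum_distrib_right[symmetric] sum_law)
    finally have "(\<Sum>\<pi>\<in>perms n. \<bar>law n (t - s) \<pi> * (\<phi> (\<pi> \<circ> (Transposition.transpose i j \<circ> \<rho>)) - \<phi> (\<pi> \<circ> \<rho>))\<bar>) \<le> L"
      using nonneg[of "t - s"] s by (simp add: abs_mult)
    then have "\<bar>\<Sum>\<pi>\<in>perms n. law n (t - s) \<pi> * (\<phi> (\<pi> \<circ> (Transposition.transpose i j \<circ> \<rho>)) - \<phi> (\<pi> \<circ> \<rho>))\<bar> \<le> L"
      by (rule order_trans[OF sum_abs])
    then show ?thesis
      by (simp add: h_def heat_translate[of n _ _ "_ \<circ> _"] heat_translate[of n _ _ \<rho>] mean_def sum_subtractf right_diff_distrib)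
  qed
  have deriv: "\<exists>y. DERIV W s :> y \<and> y \<le> N * L\<^sup>2" if s: "0 \<le> s" "s \<le> t" for s
  proof (intro exI conjI)
    let ?W' = "\<Sum>\<rho>\<in>perms n. gen_op n (law n s) \<rho> * (h s \<rho>)\<^sup>2 + law n s \<rho> * (2 * h s \<rho> * (- gen_op n (h s) \<rho>))"
    have dlaw: "((\<lambda>s. law n s \<rho>) has_real_derivative gen_op n (law n s) \<rho>) (at s)" if "\<rho> permutes {1..n}" for \<rho>
      unfolding law_def by (rule heat_has_derivative[OF that])
    have dh: "((\<lambda>s. h s \<rho>) has_real_derivative - gen_op n (h s) \<rho>) (at s)" if "\<rho> permutes {1..n}" for \<rho>
    proof -
      have "((\<lambda>s. t - s) has_real_derivative - 1) (at s)" by (auto intro!: derivative_eq_intros)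
      from DERIV_chain2[where f = "\<lambda>t. heat n t \<phi> \<rho>" and g = "\<lambda>s. t - s", OF heat_has_derivative[OF that] this]
      show ?thesis by (simp add: h_def)
    qed
    show "DERIV W s :> ?W'"
      unfolding W_def
      by (rule DERIV_sum) (auto intro!: derivative_eq_intros dlaw dh)
    have "?W' = (\<Sum>\<rho>\<in>perms n. gen_op n (law n s) \<rho> * (h s \<rho>)\<^sup>2) - (\<Sum>\<rho>\<in>perms n. law n s \<rho> * (2 * h s \<rho> * gen_op n (h s) \<rho>))"
      by (simp add: sum_subtractf)
    also have "(\<Sum>\<rho>\<in>perms n. gen_op n (law n s) \<rho> * (h s \<rho>)\<^sup>2) = (\<Sum>\<rho>\<in>perms n. law n s \<rho> * gen_op n (\<lambda>\<rho>. (h s \<rho>)\<^sup>2) \<rho>)"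
      by (rule gen_op_symmetric)
    also have "\<dots> - (\<Sum>\<rho>\<in>perms n. law n s \<rho> * (2 * h s \<rho> * gen_op n (h s) \<rho>)) =
      (\<Sum>\<rho>\<in>perms n. law n s \<rho> * (gen_op n (\<lambda>\<rho>. (h s \<rho>)\<^sup>2) \<rho> - 2 * h s \<rho> * gen_op n (h s) \<rho>))"
      by (simp add: sum_subtractf right_diff_distrib)
    also have "\<dots> \<le> (\<Sum>\<rho>\<in>perms n. law n s \<rho> * (N * L\<^sup>2))"
    proof (intro sum_mono mult_left_mono)
      fix \<rho> assume "\<rho> \<in> perms n"
      then have \<rho>: "\<rho> permutes {1..n}" by simp
      show "0 \<le> law n s \<rho>" using nonneg \<rho> s by simp
      \<comment> \<open>The squared-gradient identity for a jump generator.\<close>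
      have "gen_op n (\<lambda>\<rho>. (h s \<rho>)\<^sup>2) \<rho> - 2 * h s \<rho> * gen_op n (h s) \<rho> =
          (\<Sum>(i, j)\<in>transps n. (h s (Transposition.transpose i j \<circ> \<rho>) - h s \<rho>)\<^sup>2)"
        unfolding gen_op_def sum_distrib_left sum_subtractf[symmetric]
        by (intro sum.cong refl) (auto simp: power2_eq_square algebra_simps)
      also have "\<dots> \<le> (\<Sum>(i, j)\<in>transps n. L\<^sup>2)"
      proof (intro sum_mono, clarify)
        fix i j assume "(i, j) \<in> transps n"
        from h_Lip[OF s(2) this \<rho>] show "(h s (Transposition.transpose i j \<circ> \<rho>) - h s \<rho>)\<^sup>2 \<le> L\<^sup>2"
          by (metis abs_ge_zero power2_abs power_mono)
      qed
      also have "\<dots> = N * L\<^sup>2" by (simp add: N_def case_prod_unfold)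
      finally show "gen_op n (\<lambda>\<rho>. (h s \<rho>)\<^sup>2) \<rho> - 2 * h s \<rho> * gen_op n (h s) \<rho> \<le> N * L\<^sup>2" .
    qed
    also have "\<dots> = N * L\<^sup>2" by (simp add: sum_distrib_right[symmetric] sum_law)
    finally show "?W' \<le> N * L\<^sup>2" .
  qed
  have "0 * (N * L\<^sup>2) - W 0 \<le> t * (N * L\<^sup>2) - W t"
  proof (rule DERIV_nonneg_imp_nondecreasing[OF t])
    fix s assume "0 \<le> s" "s \<le> t"
    from deriv[OF this] obtain y where y: "DERIV W s :> y" "y \<le> N * L\<^sup>2" by auto
    then have "((\<lambda>s. s * (N * L\<^sup>2) - W s) has_real_derivative N * L\<^sup>2 - y) (at s)"
      by (auto intro!: derivative_eq_intros)
    with y show "\<exists>z. ((\<lambda>s. s * (N * L\<^sup>2) - W s) has_real_derivative z) (at s) \<and> 0 \<le> z" by force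
  qed
  moreover have "W t = mean n t (\<lambda>\<pi>. (\<phi> \<pi>)\<^sup>2)"
    by (simp add: W_def h_def mean_def heat_0)
  \<comment> \<open>At time 0 the law is the point mass at the identity, where \<open>h 0\<close> is
    the mean of \<open>\<phi>\<close> at time \<open>t\<close>.\<close>
  moreover have "W 0 = (mean n t \<phi>)\<^sup>2"
  proof -
    have "W 0 = (\<Sum>\<rho>\<in>perms n. if \<rho> = id then (h 0 id)\<^sup>2 else 0)"
      unfolding W_def law_0 by (intro sum.cong) auto
    also have "\<dots> = (h 0 id)\<^sup>2" by (simp add: permutes_id)
    finally show ?thesis by (simp add: h_def mean_eq_heat)
  qed
  ultimately show ?thesis by (simp add: N_def mult.assoc)
qed

section \<open>The mean number of points in cycles of given length\<close>

definition cycle_count :: "nat \<Rightarrow> nat \<Rightarrow> (nat \<Rightarrow> nat) \<Rightarrow> real" where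
  "cycle_count n k \<pi> = real (card {x \<in> {1..n}. card (orbit \<pi> x) = k})"

definition small_count :: "nat \<Rightarrow> nat \<Rightarrow> (nat \<Rightarrow> nat) \<Rightarrow> real" where
  "small_count n K \<pi> = real (card {x \<in> {1..n}. card (orbit \<pi> x) \<le> K})"

lemma pair_sum_gen_op: "pair_sum {1..n} F \<pi> = gen_op n F \<pi> + gen_op n F \<pi>"
proof -
  define h where "h = (\<lambda>(i, j). F (Transposition.transpose i j \<circ> \<pi>) - F \<pi>)"
  have "pair_sum {1..n} F \<pi> = sum h (SIGMA i:{1..n}. {1..n} - {i})"
    unfolding h_def by (subst sum.Sigma) auto
  also have "(SIGMA i:{1..n}. {1..n} - {i}) = transps n \<union> prod.swap ` transps n"
    by (auto simp: transps_def image_iff)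
  also have "sum h \<dots> = sum h (transps n) + sum h (prod.swap ` transps n)"
  proof (rule sum.union_disjoint)
    show "transps n \<inter> prod.swap ` transps n = {}" by (auto simp: transps_def)
  qed auto
  also have "sum h (prod.swap ` transps n) = sum (h \<circ> prod.swap) (transps n)"
    by (intro sum.reindex) (auto simp: inj_on_def)
  also have "h \<circ> prod.swap = h"
    by (auto simp: h_def fun_eq_iff transpose_commute)
  finally show ?thesis by (simp only: gen_op_def h_def)
qed

text \<open>The Euler operator in \<open>Y\<close> multiplies the coefficient of
  \<open>Y ^ j\<close> by \<open>j\<close>, so each coefficient of the observable is an
  eigenfunction.\<close>

lemma gen_op_cyc_obs_coeff:
  assumes "\<pi> permutes {1..n}" "0 < k"
  shows "gen_op n (\<lambda>\<pi>. coeff (cyc_obs {1..n} k \<pi>) j) \<pi> = - (real k * real j) * coeff (cyc_obs {1..n} k \<pi>) j"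
proof -
  let ?v = "cyc_obs {1..n} k"
  have "2 * gen_op n ?v \<pi> = 2 * - (of_nat k * ([:0, 1:] * pderiv (?v \<pi>)))"
    using pair_sum_cyc_obs[OF _ assms] by (simp only: pair_sum_gen_op mult_2 finite_atLeastAtMost)
  then have "gen_op n ?v \<pi> = - (of_nat k * ([:0, 1:] * pderiv (?v \<pi>)))"
    by (simp only: mult_cancel_left) simp
  moreover have "gen_op n (\<lambda>\<pi>. coeff (?v \<pi>) j) \<pi> = coeff (gen_op n ?v \<pi>) j"
    by (simp add: gen_op_def coeff_sum case_prod_unfold)
  ultimately have "gen_op n (\<lambda>\<pi>. coeff (?v \<pi>) j) \<pi> = - coeff (smult (real k) ([:0, 1:] * pderiv (?v \<pi>))) j"
    by (cases j) (simp_all add: of_nat_poly)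
  then show ?thesis
    by (cases j) (auto simp: coeff_pderiv)
qed

lemma mean_add: "mean n t (\<lambda>\<pi>. \<phi> \<pi> + \<psi> \<pi>) = mean n t \<phi> + mean n t \<psi>"
  and mean_diff: "mean n t (\<lambda>\<pi>. \<phi> \<pi> - \<psi> \<pi>) = mean n t \<phi> - mean n t \<psi>"
  and mean_cmult: "mean n t (\<lambda>\<pi>. c * \<phi> \<pi>) = c * mean n t \<phi>"
  by (simp_all add: mean_def sum.distrib sum_subtractf sum_distrib_left algebra_simps)

lemma mean_sum: "mean n t (\<lambda>\<pi>. \<Sum>i\<in>I. \<phi> i \<pi>) = (\<Sum>i\<in>I. mean n t (\<phi> i))"
  unfolding mean_def sum_distrib_left by (rule sum.swap)

lemma mean_cong: "(\<And>\<pi>. \<pi> permutes {1..n} \<Longrightarrow> \<phi> \<pi> = \<psi> \<pi>) \<Longrightarrow> mean n t \<phi> = mean n t \<psi>"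
  unfolding mean_def by (intro sum.cong) auto

text \<open>The coefficient of \<open>Y ^ j\<close> decays like \<open>exp (- k j t)\<close>.
  Summing the decayed coefficients at \<open>Y = 1\<close> therefore evaluates the initial
  polynomial at \<open>exp (- k t)\<close>.\<close>

theorem mean_cycle_count:
  assumes "0 < k"
  shows "mean n t (cycle_count n k) = 1 + poly (cyc_obs {1..n} k id) (exp (- (t * real k)))"
proof -
  let ?v = "cyc_obs {1..n} k"
  \<comment> \<open>A degree bound common to all permutations, so that the mean can be taken
    coefficient by coefficient.\<close>
  define d where "d = Max ((\<lambda>\<pi>. degree (?v \<pi>)) ` perms n)"
  have poly_v: "poly (?v \<pi>) x = (\<Sum>j\<le>d. coeff (?v \<pi>) j * x ^ j)" if "\<pi> permutes {1..n}" for \<pi> x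
  proof -
    have "degree (?v \<pi>) \<le> d"
      unfolding d_def using that by (intro Max_ge) auto
    then show ?thesis
      unfolding poly_altdef by (intro sum.mono_neutral_left) (auto simp: coeff_eq_0)
  qed
  have "mean n t (cycle_count n k) = mean n t (\<lambda>\<pi>. 1 + poly (?v \<pi>) 1)"
    using poly_cyc_obs_1[OF _ _ assms, of "{1..n}"] by (intro mean_cong) (simp add: cycle_count_def)
  also have "\<dots> = 1 + mean n t (\<lambda>\<pi>. \<Sum>j\<le>d. coeff (?v \<pi>) j)"
    unfolding mean_add mean_const using poly_v[of _ 1] by (simp cong: mean_cong)
  also have "mean n t (\<lambda>\<pi>. \<Sum>j\<le>d. coeff (?v \<pi>) j) = (\<Sum>j\<le>d. exp (- (real k * real j) * t) * coeff (?v id) j)"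
    unfolding mean_sum
    by (intro sum.cong refl mean_eigenfunction gen_op_cyc_obs_coeff assms)
  also have "\<dots> = (\<Sum>j\<le>d. coeff (?v id) j * exp (- (t * real k)) ^ j)"
    by (intro sum.cong refl) (simp add: exp_of_nat_mult[symmetric] mult_ac)
  finally show ?thesis by (simp add: poly_v permutes_id)
qed

definition main_term :: "nat \<Rightarrow> real \<Rightarrow> nat \<Rightarrow> real" where
  "main_term n t k = real (n choose k) * (1 - exp (- (t * real k))) ^ (k - 1) * exp (- (t * real k)) ^ (n - k)"

text \<open>The explicit mean is the main term plus 1 minus a partial sum of binomial probabilities,
  which lies between 0 and 1.\<close>

lemma mean_cycle_count_bounds:
  assumes "0 < k" "0 \<le> t"
  shows "main_term n t k \<le> mean n t (cycle_count n k)" "mean n t (cycle_count n k) \<le> main_term n t k + 1"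
proof -
  define q where "q = exp (- (t * real k))"
  have q: "0 \<le> q" "q \<le> 1" using assms by (auto simp: q_def)
  define w where "w j = real (n choose j) * (1 - q) ^ j * q ^ (n - j)" for j
  have w: "0 \<le> w j" for j unfolding w_def using q by simp
  \<comment> \<open>The range up to \<open>n + k\<close> also covers \<open>k > n\<close>; the
    weights beyond \<open>n\<close> are 0.\<close>
  have "(\<Sum>j\<le>k. w j) \<le> (\<Sum>j\<le>n + k. w j)"
    using w by (intro sum_mono2) auto
  also have "\<dots> = (\<Sum>j\<le>n. w j)"
    by (intro sum.mono_neutral_right) (auto simp: w_def)
  also have "\<dots> = (1 - q + q) ^ n" unfolding w_def by (rule binomial_ring[symmetric])
  finally have "(\<Sum>j\<le>k. w j) \<le> 1" by simp
  moreover have "0 \<le> (\<Sum>j\<le>k. w j)" using w by (intro sum_nonneg)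
  moreover have "mean n t (cycle_count n k) = 1 + (main_term n t k - (\<Sum>j\<le>k. w j))"
    unfolding mean_cycle_count[OF assms(1)] by (simp add: poly_cyc_obs_id assms main_term_def w_def q_def)
  ultimately show "main_term n t k \<le> mean n t (cycle_count n k)"
    "mean n t (cycle_count n k) \<le> main_term n t k + 1" by linarith+
qed

section \<open>Points in short cycles\<close>

lemma small_count_eq_sum:
  assumes "\<pi> permutes {1..n}"
  shows "small_count n K \<pi> = (\<Sum>k=1..K. cycle_count n k \<pi>)"
proof -
  have "1 \<le> card (orbit \<pi> x)" for x
  proof -
    have "0 < card (orbit \<pi> x)" by (rule orbit_enum[OF assms, of x]) auto
    then show ?thesis by linarith
  qed
  then have "{x \<in> {1..n}. card (orbit \<pi> x) \<le> K} = (\<Union>k\<in>{1..K}. {x \<in> {1..n}. card (orbit \<pi> x) = k})"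
    by auto
  then have "card {x \<in> {1..n}. card (orbit \<pi> x) \<le> K} = (\<Sum>k=1..K. card {x \<in> {1..n}. card (orbit \<pi> x) = k})"
    by (simp only:) (rule card_UN_disjoint, auto)
  then show ?thesis by (simp add: small_count_def cycle_count_def)
qed

text \<open>A point can leave the short cycles only if its own cycle contains \<open>i\<close> or
  \<open>j\<close>, and two cycles of length at most \<open>K\<close> hold at most
  \<open>2 * K\<close> points. The other direction is the same bound for the composed permutation,
  as a transposition is its own inverse.\<close>

lemma small_count_Lipschitz:
  assumes "i \<in> {1..n}" "j \<in> {1..n}" "\<pi> permutes {1..n}"
  shows "\<bar>small_count n K (Transposition.transpose i j \<circ> \<pi>) - small_count n K \<pi>\<bar> \<le> 2 * real K"
proof -
  have le: "small_count n K f - small_count n K (Transposition.transpose i j \<circ> f) \<le> 2 * real K"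
    if f: "f permutes {1..n}" for f
  proof -
    let ?A = "{x \<in> {1..n}. card (orbit f x) \<le> K}" and ?g = "Transposition.transpose i j \<circ> f"
    let ?B = "{x \<in> {1..n}. card (orbit ?g x) \<le> K}"
    define O' where "O' y = {x \<in> orbit f y. card (orbit f y) \<le> K}" for y
    have "finite (orbit f y)" for y
      using f by (intro finite_orbit permutation_self_in_orbit) (auto simp: permutation_permutes)
    then have O': "card (O' y) \<le> K" "finite (O' y)" for y
      by (cases "card (orbit f y) \<le> K"; simp add: O'_def)+
    have "?A \<subseteq> ?B \<union> (O' i \<union> O' j)"
    proof
      fix x assume x: "x \<in> ?A"
      show "x \<in> ?B \<union> (O' i \<union> O' j)"
      proof (cases "i \<in> orbit f x \<or> j \<in> orbit f x")
        case True
        then obtain y where y: "y \<in> {i, j}" "y \<in> orbit f x" by blast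
        have "x \<in> orbit f x" using f by (intro permutation_self_in_orbit) (auto simp: permutation_permutes)
        moreover have "orbit f x = orbit f y" using orbit_eq_iff[OF f, of x y] y(2) by simp
        ultimately have "x \<in> O' y" using x by (simp add: O'_def)
        then show ?thesis using y(1) by blast
      next
        case False
        then show ?thesis using x orbit_transpose_other[OF f, of i x j] by auto
      qed
    qed
    then have "card ?A \<le> card (?B \<union> (O' i \<union> O' j))"
      using O' by (intro card_mono) auto
    also have "\<dots> \<le> card ?B + (card (O' i) + card (O' j))"
      by (meson add_left_mono card_Un_le order_trans)
    also have "\<dots> \<le> card ?B + (K + K)" using O' by (intro add_mono) auto
    finally show ?thesis by (simp add: small_count_def)
  qed
  have "Transposition.transpose i j \<circ> \<pi> permutes {1..n}"
    using assms by (intro permutes_compose permutes_swap_id)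
  from le[OF assms(3)] le[OF this] show ?thesis
    by (simp add: abs_le_iff comp_assoc[symmetric])
qed

text \<open>Convolution with a transposition evaluates at the inverse transposition composed with
  \<open>\<pi>\<close>. Transpositions being involutions, this is the action of
  \<open>gen_op\<close>.\<close>

lemma ga_power_generator:
  assumes "\<pi> permutes {1..n}"
  shows "ga_power n (\<lambda>\<tau>. complex_of_real s * interchange_generator n \<tau>) m \<pi> =
    complex_of_real (s ^ m * (gen_op n ^^ m) dirac_id \<pi>)"
  using assms
proof (induction m arbitrary: \<pi>)
  case 0
  then show ?case by (simp add: ga_basis_def dirac_id_def)
next
  case (Suc m)
  let ?r = "(gen_op n ^^ m) dirac_id"
  let ?G = "\<lambda>\<rho>. complex_of_real (s ^ m * ?r (inv \<rho> \<circ> \<pi>))"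
  have basis: "(\<Sum>\<rho>\<in>perms n. ga_basis \<tau> \<rho> * H \<rho>) = H \<tau>" if "\<tau> permutes {1..n}" for \<tau> and H :: "_ \<Rightarrow> complex"
    using that by (simp add: ga_basis_def if_distrib[of "\<lambda>x. x * _"] cong: if_cong)
  have "ga_power n (\<lambda>\<tau>. complex_of_real s * interchange_generator n \<tau>) (Suc m) \<pi> =
      (\<Sum>\<rho>\<in>perms n. complex_of_real s * interchange_generator n \<rho> * ?G \<rho>)"
    unfolding ga_power.simps ga_mult_def
    using Suc.IH permutes_compose[OF Suc.prems permutes_inv] by (intro sum.cong refl) auto
  also have "\<dots> = complex_of_real s * (\<Sum>(i, j)\<in>transps n. \<Sum>\<rho>\<in>perms n.
      (ga_basis (Transposition.transpose i j) \<rho> - ga_basis id \<rho>) * ?G \<rho>)"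
    unfolding interchange_generator_def transps_def[symmetric] sum_distrib_left sum_distrib_right
    by (subst sum.swap) (simp add: case_prod_unfold sum_distrib_left mult_ac)
  also have "\<dots> = complex_of_real s * (\<Sum>(i, j)\<in>transps n. ?G (Transposition.transpose i j) - ?G id)"
    using transpose_permutes
    by (intro arg_cong[of _ _ "(*) _"] sum.cong refl) (auto simp: left_diff_distrib sum_subtractf basis permutes_id)
  also have "\<dots> = complex_of_real (s ^ Suc m * (gen_op n ^^ Suc m) dirac_id \<pi>)"
    unfolding funpow.simps o_apply[of "gen_op n"] gen_op_def[of n ?r]
    by (simp add: case_prod_unfold inv_transpose_eq sum_distrib_left right_diff_distrib mult_ac)
  finally show ?case .
qed

lemma ga_exp_generator:
  assumes "\<pi> permutes {1..n}"
  shows "ga_exp n (\<lambda>\<tau>. complex_of_real s * interchange_generator n \<tau>) \<pi> = complex_of_real (law n s \<pi>)"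
proof -
  have "ga_exp n (\<lambda>\<tau>. complex_of_real s * interchange_generator n \<tau>) \<pi> =
      (\<Sum>m. complex_of_real ((gen_op n ^^ m) dirac_id \<pi> / fact m * s ^ m))"
    unfolding ga_exp_def ga_power_generator[OF assms] by (simp add: mult_ac)
  also have "\<dots> = complex_of_real (law n s \<pi>)"
    unfolding law_def heat_def by (rule suminf_of_real[OF summable_heat[OF assms], symmetric])
  finally show ?thesis .
qed

section \<open>Probabilities of the process at a fixed time\<close>

context interchange_process
begin

lemma event_state: "0 \<le> t \<Longrightarrow> {\<omega> \<in> space M. P (\<sigma> t \<omega>)} \<in> events"
proof -
  assume "0 \<le> t"
  from measurable_state[OF this] have "\<sigma> t -` {\<pi> \<in> perms n. P \<pi>} \<inter> space M \<in> events"
    by (rule measurable_sets) auto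
  moreover have "\<sigma> t -` {\<pi> \<in> perms n. P \<pi>} \<inter> space M = {\<omega> \<in> space M. P (\<sigma> t \<omega>)}"
    using measurable_space[OF measurable_state[OF \<open>0 \<le> t\<close>]] by auto
  ultimately show ?thesis by simp
qed

text \<open>The transition rule is applied with the single past time 0, where the state is almost
  surely the identity.\<close>

lemma prob_state_eq:
  assumes "0 \<le> t" "\<rho> permutes {1..n}"
  shows "prob {\<omega> \<in> space M. \<sigma> t \<omega> = \<rho>} = law n t \<rho>"
proof -
  have "complex_of_real (prob {\<omega> \<in> space M. \<sigma> 0 \<omega> = id \<and> \<sigma> t \<omega> = \<rho>}) =
      complex_of_real (prob {\<omega> \<in> space M. \<sigma> 0 \<omega> = id}) * complex_of_real (law n t \<rho>)"
    using transition[of "\<lambda>_. 0" 0 t "\<lambda>_. id" \<rho>] assms by (simp add: permutes_id ga_exp_generator)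
  moreover have "prob {\<omega> \<in> space M. \<sigma> 0 \<omega> = id} = 1"
    using start event_state[of 0] by (simp add: prob_eq_1)
  moreover have "prob {\<omega> \<in> space M. \<sigma> 0 \<omega> = id \<and> \<sigma> t \<omega> = \<rho>} = prob {\<omega> \<in> space M. \<sigma> t \<omega> = \<rho>}"
  proof (rule finite_measure_eq_AE)
    show "AE \<omega> in M. \<omega> \<in> {\<omega> \<in> space M. \<sigma> 0 \<omega> = id \<and> \<sigma> t \<omega> = \<rho>} \<longleftrightarrow> \<omega> \<in> {\<omega> \<in> space M. \<sigma> t \<omega> = \<rho>}"
      using start by eventually_elim auto
    show "{\<omega> \<in> space M. \<sigma> 0 \<omega> = id \<and> \<sigma> t \<omega> = \<rho>} \<in> events"
      using event_state[of 0 "\<lambda>\<pi>. \<pi> = id"] event_state[OF assms(1), of "\<lambda>\<pi>. \<pi> = \<rho>"]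
        sets.Int[of "{\<omega> \<in> space M. \<sigma> 0 \<omega> = id}" M "{\<omega> \<in> space M. \<sigma> t \<omega> = \<rho>}"]
      by (simp add: Int_def conj_ac)
  qed (rule event_state[OF assms(1)])
  ultimately show ?thesis by simp
qed

text \<open>The exponential series has terms of both signs in general; nonnegativity is read off
  from a process having this law.\<close>

lemma law_nonneg: "0 \<le> t \<Longrightarrow> \<rho> permutes {1..n} \<Longrightarrow> 0 \<le> law n t \<rho>"
  using prob_state_eq by (metis measure_nonneg)

lemma prob_state:
  assumes "0 \<le> t"
  shows "prob {\<omega> \<in> space M. P (\<sigma> t \<omega>)} = mean n t (\<lambda>\<pi>. of_bool (P \<pi>))"
proof -
  have "{\<omega> \<in> space M. P (\<sigma> t \<omega>)} = (\<Union>\<pi>\<in>{\<pi>\<in>perms n. P \<pi>}. {\<omega> \<in> space M. \<sigma> t \<omega> = \<pi>})"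
    using measurable_space[OF measurable_state[OF assms]] by auto
  also have "prob \<dots> = (\<Sum>\<pi>\<in>{\<pi>\<in>perms n. P \<pi>}. prob {\<omega> \<in> space M. \<sigma> t \<omega> = \<pi>})"
    using event_state[OF assms] by (intro finite_measure_finite_Union) (auto simp: disjoint_family_on_def)
  also have "\<dots> = (\<Sum>\<pi>\<in>{\<pi>\<in>perms n. P \<pi>}. law n t \<pi>)"
    using prob_state_eq[OF assms] by (intro sum.cong) auto
  also have "\<dots> = mean n t (\<lambda>\<pi>. of_bool (P \<pi>))"
    unfolding mean_def by (intro sum.mono_neutral_cong_left) auto
  finally show ?thesis .
qed

end

section \<open>Asymptotics for \<open>t = c/n\<close>\<close>

lemma binomial_over_power_tendsto: "(\<lambda>n. real (n choose k) / real n ^ k) \<longlonglongrightarrow> 1 / fact k"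
proof (induction k)
  case 0
  then show ?case by simp
next
  case (Suc k)
  have "(\<lambda>n. (real n - real k) / real n) \<longlonglongrightarrow> 1" by real_asymp
  from tendsto_divide[OF tendsto_mult[OF Suc this] tendsto_const[of "real (Suc k)"]]
  have "(\<lambda>n. real (n choose k) / real n ^ k * ((real n - real k) / real n) / real (Suc k)) \<longlonglongrightarrow> 1 / fact (Suc k)"
    by (simp add: field_simps)
  then show ?case
  proof (rule Lim_transform_eventually)
    show "\<forall>\<^sub>F n in sequentially. real (n choose k) / real n ^ k * ((real n - real k) / real n) / real (Suc k) =
        real (n choose Suc k) / real n ^ Suc k"
      using eventually_ge_at_top[of k]
    proof eventually_elim
      case (elim n)
      have "Suc k * (n choose Suc k) = (n - k) * (n choose k)"
        by (simp only: binomial_absorption binomial_absorb_comp)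
      then have "real (Suc k) * real (n choose Suc k) = (real n - real k) * real (n choose k)"
        using elim by (metis of_nat_diff of_nat_mult)
      then have "real (n choose Suc k) = (real n - real k) * real (n choose k) / real (Suc k)"
        by (metis nonzero_mult_div_cancel_left of_nat_eq_0_iff nat.distinct(1))
      then show ?case by (simp add: mult_ac)
    qed
  qed
qed

text \<open>The Borel distribution: the probability that a branching process with Poisson offspring
  of mean \<open>c\<close> has total progeny \<open>k\<close>.\<close>

definition borel_weight :: "real \<Rightarrow> nat \<Rightarrow> real" where
  "borel_weight c k = (c * real k) ^ (k - 1) * exp (- (c * real k)) / fact k"

text \<open>Each of the \<open>k - 1\<close> factors \<open>1 - exp (- a / n)\<close> is close to
  \<open>a / n\<close>, so all but one of the \<open>k\<close> powers of \<open>n\<close> in the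
  binomial coefficient cancel.\<close>

lemma main_term_tendsto:
  assumes "0 < c" "0 < k"
  shows "(\<lambda>n. main_term n (c / real n) k / real n) \<longlonglongrightarrow> borel_weight c k"
proof -
  define a where "a = c * real k"
  have a: "0 < a" using assms by (simp add: a_def)
  have "(\<lambda>n. real n * (1 - exp (- (a / real n)))) \<longlonglongrightarrow> a" using a by real_asymp
  moreover have "(\<lambda>n. exp (- (a / real n) * (real n - real k))) \<longlonglongrightarrow> exp (- a)" using a by real_asymp
  ultimately have lim: "(\<lambda>n. real (n choose k) / real n ^ k * (real n * (1 - exp (- (a / real n)))) ^ (k - 1) *
      exp (- (a / real n) * (real n - real k))) \<longlonglongrightarrow> 1 / fact k * a ^ (k - 1) * exp (- a)"
    by (intro tendsto_mult tendsto_power binomial_over_power_tendsto)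
  have eq: "1 / fact k * a ^ (k - 1) * exp (- a) = borel_weight c k"
    by (simp add: borel_weight_def a_def)
  have "\<forall>\<^sub>F n in sequentially. real (n choose k) / real n ^ k * (real n * (1 - exp (- (a / real n)))) ^ (k - 1) *
      exp (- (a / real n) * (real n - real k)) = main_term n (c / real n) k / real n"
    using eventually_ge_at_top[of "max k 1"]
  proof eventually_elim
    case (elim n)
    have "real n ^ k = real n * real n ^ (k - 1)"
      using assms(2) by (cases k) auto
    moreover have "exp (- (a / real n) * (real n - real k)) = exp (- (a / real n)) ^ (n - k)"
      using elim by (simp add: exp_of_nat_mult[symmetric] of_nat_diff mult_ac)
    moreover have "c / real n * real k = a / real n" by (simp add: a_def)
    ultimately show ?case
      using elim unfolding main_term_def by (simp add: power_mult_distrib)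
  qed
  then show ?thesis by (rule Lim_transform_eventually[OF lim[unfolded eq]])
qed

lemma power_self_le_exp_fact: "real k ^ k \<le> exp (real k) * fact k"
proof -
  have s: "summable (\<lambda>m. real k ^ m /\<^sub>R fact m)" by (rule summable_exp_generic)
  have "(\<Sum>m\<in>{k}. real k ^ m /\<^sub>R fact m) \<le> (\<Sum>m. real k ^ m /\<^sub>R fact m)"
    by (rule sum_le_suminf[OF s]) auto
  also have "\<dots> = exp (real k)" by (simp add: exp_def)
  finally show ?thesis by (simp add: field_simps)
qed

text \<open>Uses \<open>n ^ k / fact k\<close> for the binomial coefficient,
  \<open>1 - exp (- x) \<le> x\<close>, and \<open>k ^ k / fact k \<le> exp k\<close>. The condition
  on \<open>\<epsilon>\<close> keeps \<open>n - k\<close> at least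
  \<open>(1 - \<epsilon>) n\<close>.\<close>

lemma main_term_le:
  assumes "1 \<le> c" "0 < k" "k \<le> n" "real k \<le> \<epsilon> * real n"
  shows "main_term n (c / real n) k \<le> real n * (c * exp (1 - c * (1 - \<epsilon>))) ^ k"
proof -
  define x where "x = c / real n * real k"
  have n: "0 < real n" using assms by simp
  have x0: "0 \<le> x" using assms by (simp add: x_def)
  have "real ((n choose k) * fact k) \<le> real (n ^ k)"
    by (rule of_nat_mono[OF binomial_fact_pow])
  then have B: "real (n choose k) \<le> real n ^ k / fact k"
    by (simp add: field_simps)
  have P: "(1 - exp (- x)) ^ (k - 1) \<le> x ^ (k - 1)"
    using exp_ge_add_one_self[of "- x"] x0 by (intro power_mono) auto
  have "exp (- x) ^ (n - k) = exp (- (real (n - k) * x))"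
    using exp_of_nat_mult[of "n - k" "- x"] by simp
  also have "real (n - k) * x = c * real k - c * real k * (real k / real n)"
    using assms(3) n by (simp add: x_def of_nat_diff field_simps)
  also have "exp (- \<dots>) \<le> exp (- (c * real k * (1 - \<epsilon>)))"
  proof -
    have "c * real k * (real k / real n) \<le> c * real k * \<epsilon>"
      using assms n by (intro mult_left_mono) (auto simp: field_simps)
    then show ?thesis by (simp add: right_diff_distrib)
  qed
  finally have E: "exp (- x) ^ (n - k) \<le> exp (- (c * real k * (1 - \<epsilon>)))" .
  have "main_term n (c / real n) k \<le> real n ^ k / fact k * x ^ (k - 1) * exp (- (c * real k * (1 - \<epsilon>)))"
    unfolding main_term_def x_def[symmetric] using B P E x0
    by (intro mult_mono) auto
  also have "real n ^ k / fact k * x ^ (k - 1) = real n * ((c * real k) ^ (k - 1) / fact k)"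
  proof -
    have "real n ^ k = real n * real n ^ (k - 1)" using assms(2) by (cases k) auto
    then show ?thesis using n by (simp add: x_def power_divide power_mult_distrib)
  qed
  \<comment> \<open>The exponent may be raised because \<open>c * k\<close> is at least 1.\<close>
  also have "(c * real k) ^ (k - 1) / fact k \<le> (c * real k) ^ k / fact k"
  proof (intro divide_right_mono power_increasing)
    have "1 * 1 \<le> c * real k" using assms by (intro mult_mono) auto
    then show "1 \<le> c * real k" by simp
  qed auto
  also have "\<dots> \<le> c ^ k * exp (real k)"
    using power_self_le_exp_fact[of k] mult_left_mono[OF power_self_le_exp_fact[of k], of "c ^ k"] assms
    by (simp add: power_mult_distrib field_simps)
  also have "real n * (c ^ k * exp (real k)) * exp (- (c * real k * (1 - \<epsilon>))) =
      real n * (c ^ k * (exp (real k) * exp (- (c * real k * (1 - \<epsilon>)))))"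
    by simp
  also have "exp (real k) * exp (- (c * real k * (1 - \<epsilon>))) = exp (1 - c * (1 - \<epsilon>)) ^ k"
    by (simp add: exp_add[symmetric] exp_of_nat_mult[symmetric] algebra_simps)
  finally have "main_term n (c / real n) k \<le> real n * (c ^ k * exp (1 - c * (1 - \<epsilon>)) ^ k)"
    by (simp add: mult_left_mono mult_right_mono)
  then show ?thesis by (simp only: power_mult_distrib)
qed

text \<open>On the interval from 0 to 1 the function \<open>x * exp (- x)\<close> passes from 0 to
  \<open>exp (- 1)\<close>, which is its upper bound at \<open>c\<close> as well.\<close>

lemma dual_parameter:
  fixes c :: real
  assumes "1 < c"
  obtains c' where "0 < c'" "c' \<le> 1" "c' * exp (- c') = c * exp (- c)"
proof -
  have "c * exp (- c) \<le> exp (c - 1) * exp (- c)"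
    using exp_ge_add_one_self[of "c - 1"] by (intro mult_right_mono) auto
  also have "\<dots> = 1 * exp (- 1)" by (simp add: exp_add[symmetric])
  finally have le: "c * exp (- c) \<le> 1 * exp (- 1)" .
  have "\<exists>x\<ge>0. x \<le> 1 \<and> x * exp (- x) = c * exp (- c)"
    using le assms by (intro IVT' continuous_intros) auto
  then obtain x where x: "0 \<le> x" "x \<le> 1" "x * exp (- x) = c * exp (- c)" by blast
  moreover have "x \<noteq> 0" using x(3) assms by auto
  ultimately show ?thesis using that[of x] by simp
qed

text \<open>Multiplied by \<open>c\<close>, the weight depends on \<open>c\<close> only through
  \<open>c * exp (- c)\<close>.\<close>

lemma borel_weight_dual:
  assumes "c' * exp (- c') = c * exp (- c)" "0 < k"
  shows "c * borel_weight c k = c' * borel_weight c' k"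
proof -
  have "c * borel_weight c k = (c * exp (- c)) ^ k * real k ^ (k - 1) / fact k" for c
  proof -
    have "exp (- (c * real k)) = exp (- c) ^ k" by (simp add: exp_of_nat_mult[symmetric] mult.commute)
    moreover have "c ^ k = c * c ^ (k - 1)" using assms(2) by (cases k) auto
    ultimately show ?thesis by (simp add: borel_weight_def power_mult_distrib mult_ac)
  qed
  then show ?thesis by (simp only: assms(1))
qed

lemma mean_small_count: "mean n t (small_count n K) = (\<Sum>k=1..K. mean n t (cycle_count n k))"
  unfolding mean_sum[symmetric] using small_count_eq_sum by (rule mean_cong)

lemma largest_cycle_le_imp_small_count:
  assumes "\<pi> permutes {1..n}" "1 \<le> n" "largest_cycle_length n \<pi> \<le> M"
  shows "small_count n M \<pi> = real n"
proof -
  have "card (orbit \<pi> x) \<le> M" if "x \<in> {1..n}" for x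
  proof -
    have "card (orbit \<pi> x) \<le> largest_cycle_length n \<pi>"
      unfolding largest_cycle_length_def using that by (intro Max_ge) auto
    then show ?thesis using assms(3) by simp
  qed
  then have "{x \<in> {1..n}. card (orbit \<pi> x) \<le> M} = {1..n}" by auto
  then show ?thesis by (simp add: small_count_def)
qed

lemma small_count_mono: "K \<le> M \<Longrightarrow> small_count n K \<pi> \<le> small_count n M \<pi>"
  unfolding small_count_def by (intro of_nat_mono card_mono) auto

section \<open>Estimates based on nonnegativity of the law\<close>

context
  assumes law_nonneg: "\<And>n t \<pi>. 1 \<le> n \<Longrightarrow> 0 \<le> t \<Longrightarrow> \<pi> permutes {1..n} \<Longrightarrow> 0 \<le> law n t \<pi>"
begin

lemma mean_le:
  assumes "1 \<le> n" "0 \<le> t" "\<And>\<pi>. \<pi> permutes {1..n} \<Longrightarrow> \<phi> \<pi> \<le> \<psi> \<pi>"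
  shows "mean n t \<phi> \<le> mean n t \<psi>"
  unfolding mean_def using law_nonneg[OF assms(1,2)] assms(3) by (intro sum_mono mult_left_mono) auto

text \<open>The sum is a limit of lower bounds for the mean fraction of points in cycles of length
  at most \<open>K\<close>.\<close>

lemma sum_borel_weight_le_1:
  assumes "0 < c"
  shows "(\<Sum>k=1..K. borel_weight c k) \<le> 1"
proof (rule LIMSEQ_le_const2)
  show "(\<lambda>n. \<Sum>k=1..K. main_term n (c / real n) k / real n) \<longlonglongrightarrow> (\<Sum>k=1..K. borel_weight c k)"
    using assms by (intro tendsto_sum main_term_tendsto) auto
  have "(\<Sum>k=1..K. main_term n (c / real n) k / real n) \<le> 1" if n: "1 \<le> n" for n
  proof -
    have t: "0 \<le> c / real n" using assms by simp
    have "(\<Sum>k=1..K. main_term n (c / real n) k) \<le> (\<Sum>k=1..K. mean n (c / real n) (cycle_count n k))"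
      using mean_cycle_count_bounds(1) t by (intro sum_mono) auto
    also have "\<dots> = mean n (c / real n) (small_count n K)" by (simp add: mean_small_count)
    also have "\<dots> \<le> mean n (c / real n) (\<lambda>_. real n * 1)"
    proof (rule mean_le[OF n t])
      fix \<pi>
      have "card {x \<in> {1..n}. card (orbit \<pi> x) \<le> K} \<le> card {1..n}"
        by (intro card_mono) auto
      then show "small_count n K \<pi> \<le> real n * 1" by (simp add: small_count_def)
    qed
    also have "\<dots> = real n" unfolding mean_cmult mean_const by simp
    finally show ?thesis using n by (simp add: sum_divide_distrib[symmetric])
  qed
  then show "\<exists>N. \<forall>n\<ge>N. (\<Sum>k=1..K. main_term n (c / real n) k / real n) \<le> 1" by blast
qed

text \<open>
  The \<open>c\<close>-weights are \<open>c'/c\<close> times the weights of the dual parameter \<open>c' \<le> 1\<close>, and those sum to at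
  most 1 because they are limits of means of the interchange process at time \<open>c'/n\<close>.
\<close>

lemma sum_borel_weight_supercritical:
  assumes "1 < c"
  obtains \<theta> where "0 < \<theta>" "\<And>K. (\<Sum>k=1..K. borel_weight c k) \<le> 1 - \<theta>"
proof -
  obtain c' where c': "0 < c'" "c' \<le> 1" "c' * exp (- c') = c * exp (- c)"
    using dual_parameter[OF assms] .
  have "(\<Sum>k=1..K. borel_weight c k) \<le> 1 - (1 - c' / c)" for K
  proof -
    have "(\<Sum>k=1..K. borel_weight c k) = (\<Sum>k=1..K. c' / c * borel_weight c' k)"
      using borel_weight_dual[OF c'(3)] assms by (intro sum.cong refl) (simp add: field_simps)
    also have "\<dots> = c' / c * (\<Sum>k=1..K. borel_weight c' k)" by (simp add: sum_distrib_left)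
    also have "\<dots> \<le> c' / c * 1"
      using sum_borel_weight_le_1[OF c'(1)] c'(1) assms by (intro mult_left_mono) auto
    finally show ?thesis by simp
  qed
  moreover have "0 < 1 - c' / c" using c' assms by simp
  ultimately show ?thesis using that by blast
qed

text \<open>The \<open>K\<close> additive errors are negligible against \<open>n\<close>. Giving up
  a quarter of \<open>\<theta>\<close> leaves room for the convergence.\<close>

lemma mean_small_count_eventually_le:
  assumes c: "1 < c" and \<theta>: "\<And>K. (\<Sum>k=1..K. borel_weight c k) \<le> 1 - \<theta>" "0 < \<theta>"
  shows "\<forall>\<^sub>F n in sequentially. mean n (c / real n) (small_count n K) \<le> (1 - 3 / 4 * \<theta>) * real n"
proof -
  have "(\<lambda>n. real K / real n) \<longlonglongrightarrow> 0" by real_asymp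
  moreover have "(\<lambda>n. \<Sum>k=1..K. main_term n (c / real n) k / real n) \<longlonglongrightarrow> (\<Sum>k=1..K. borel_weight c k)"
    using c by (intro tendsto_sum main_term_tendsto) auto
  ultimately have "(\<lambda>n. real K / real n + (\<Sum>k=1..K. main_term n (c / real n) k / real n)) \<longlonglongrightarrow>
      0 + (\<Sum>k=1..K. borel_weight c k)"
    by (rule tendsto_add)
  moreover have "0 + (\<Sum>k=1..K. borel_weight c k) < 1 - 3 / 4 * \<theta>"
    using \<theta>(1)[of K] \<theta>(2) by simp
  ultimately have "\<forall>\<^sub>F n in sequentially. real K / real n + (\<Sum>k=1..K. main_term n (c / real n) k / real n) < 1 - 3 / 4 * \<theta>"
    by (rule order_tendstoD(2))
  then show ?thesis
    using eventually_ge_at_top[of 1]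
  proof eventually_elim
    case (elim n)
    have "mean n (c / real n) (small_count n K) \<le> (\<Sum>k=1..K. main_term n (c / real n) k + 1)"
      unfolding mean_small_count using mean_cycle_count_bounds(2) c by (intro sum_mono) auto
    also have "\<dots> = real n * (real K / real n + (\<Sum>k=1..K. main_term n (c / real n) k / real n))"
      using elim(2) by (simp add: sum.distrib sum_divide_distrib[symmetric] field_simps)
    also have "\<dots> \<le> real n * (1 - 3 / 4 * \<theta>)"
      using elim by (intro mult_left_mono) auto
    finally show ?case by (simp add: mult.commute)
  qed
qed

text \<open>The errors of at most 1 per length add up to at most \<open>M\<close>, hence to
  \<open>\<epsilon> n\<close>; the main terms are bounded by a geometric tail.\<close>

lemma sum_mean_medium_le:
  assumes c: "1 < c" and n: "1 \<le> n" and M: "real M \<le> \<epsilon> * real n" "M \<le> n"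
    and \<rho>: "c * exp (1 - c * (1 - \<epsilon>)) \<le> \<rho>" "\<rho> < 1"
  shows "(\<Sum>k=Suc K..M. mean n (c / real n) (cycle_count n k)) \<le> real n * (\<epsilon> + \<rho> ^ Suc K / (1 - \<rho>))"
proof -
  have \<rho>0: "0 \<le> \<rho>" using \<rho>(1) c by (smt (verit) exp_gt_zero mult_pos_pos)
  have "(\<Sum>k=Suc K..M. mean n (c / real n) (cycle_count n k)) \<le> (\<Sum>k=Suc K..M. real n * \<rho> ^ k + 1)"
  proof (intro sum_mono)
    fix k assume k: "k \<in> {Suc K..M}"
    have "real k \<le> real M" using k by simp
    then have "main_term n (c / real n) k \<le> real n * (c * exp (1 - c * (1 - \<epsilon>))) ^ k"
      using k M c by (intro main_term_le) auto
    also have "\<dots> \<le> real n * \<rho> ^ k"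
      using \<rho> c by (intro mult_left_mono power_mono) auto
    finally show "mean n (c / real n) (cycle_count n k) \<le> real n * \<rho> ^ k + 1"
      using mean_cycle_count_bounds(2)[of k "c / real n" n] k c by auto
  qed
  also have "\<dots> \<le> real n * (\<Sum>k=Suc K..M. \<rho> ^ k) + real M"
    by (simp add: sum.distrib sum_distrib_left)
  also have "(\<Sum>k=Suc K..M. \<rho> ^ k) \<le> \<rho> ^ Suc K / (1 - \<rho>)"
  proof -
    have "(\<Sum>k=Suc K..M. \<rho> ^ k) \<le> (\<Sum>k=Suc K..M + Suc K. \<rho> ^ k)"
      using \<rho>0 by (intro sum_mono2) auto
    also have "\<dots> = \<rho> ^ Suc K * (\<Sum>k\<le>M. \<rho> ^ k)"
      using sum.shift_bounds_cl_nat_ivl[of "\<lambda>k. \<rho> ^ k" 0 "Suc K" M]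
      by (simp add: power_add sum_distrib_left atLeast0AtMost mult_ac)
    also have "(\<Sum>k\<le>M. \<rho> ^ k) \<le> (\<Sum>k. \<rho> ^ k)"
      using \<rho>0 \<rho>(2) by (intro sum_le_suminf summable_geometric) auto
    also have "\<dots> = 1 / (1 - \<rho>)" using \<rho>0 \<rho>(2) by (simp add: suminf_geometric)
    finally show ?thesis using \<rho>0 by (simp add: mult_left_mono)
  qed
  finally have "(\<Sum>k=Suc K..M. mean n (c / real n) (cycle_count n k)) \<le> real n * (\<rho> ^ Suc K / (1 - \<rho>)) + real M"
    by (simp add: mult_left_mono)
  then show ?thesis using M(1) unfolding distrib_left mult.commute[of "real n" \<epsilon>] by linarith
qed

text \<open>If no cycle is longer than \<open>M\<close>, either at least
  \<open>\<theta> n / 2\<close> points lie in cycles of length between \<open>Suc K\<close> and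
  \<open>M\<close>, or the count up to \<open>K\<close> exceeds its mean by at least
  \<open>\<theta> n / 4\<close>. Markov's inequality handles the first case, Chebyshev's the
  second.\<close>

lemma small_cycles_prob_bound:
  assumes c: "1 < c" and n: "1 \<le> n" and \<theta>: "0 < \<theta>" and \<epsilon>: "0 < \<epsilon>" "\<epsilon> < 1"
    and K: "real K \<le> \<epsilon> * real n"
    and \<mu>: "mean n (c / real n) (small_count n K) \<le> (1 - 3 / 4 * \<theta>) * real n"
    and \<rho>: "c * exp (1 - c * (1 - \<epsilon>)) \<le> \<rho>" "\<rho> < 1"
  shows "mean n (c / real n) (\<lambda>\<pi>. of_bool (real (largest_cycle_length n \<pi>) \<le> real n * \<epsilon>)) \<le>
    2 / \<theta> * (\<epsilon> + \<rho> ^ Suc K / (1 - \<rho>)) + 64 * c * (real K)\<^sup>2 / \<theta>\<^sup>2 / real n"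
proof -
  define t where "t = c / real n"
  define \<mu> where "\<mu> = mean n t (small_count n K)"
  define M where "M = nat \<lfloor>real n * \<epsilon>\<rfloor>"
  have t: "0 \<le> t" and n0: "0 < real n" using c n by (auto simp: t_def)
  have M: "real M \<le> \<epsilon> * real n" using \<epsilon> n by (simp add: M_def mult.commute)
  have Mn: "M \<le> n"
  proof -
    have "\<epsilon> * real n \<le> 1 * real n" using \<epsilon> by (intro mult_right_mono) auto
    then show ?thesis using M by linarith
  qed
  have KM: "K \<le> M" using K by (simp add: M_def le_nat_floor mult.commute)
  \<comment> \<open>\<open>A\<close> and \<open>B\<close> are the reciprocals of
    \<open>\<theta> n / 2\<close> and of the square of \<open>\<theta> n / 4\<close>, so the
    matching term is at least 1 in either case.\<close>
  define A where "A = 2 / (\<theta> * real n)"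
  define B where "B = 16 / (\<theta>\<^sup>2 * (real n)\<^sup>2)"
  have A0: "0 \<le> A" and B0: "0 \<le> B" using \<theta> by (auto simp: A_def B_def)
  have le: "of_bool (real (largest_cycle_length n \<pi>) \<le> real n * \<epsilon>) \<le>
      A * (small_count n M \<pi> - small_count n K \<pi>) + B * (small_count n K \<pi> - \<mu>)\<^sup>2"
    if \<pi>: "\<pi> permutes {1..n}" for \<pi>
  proof (cases "real (largest_cycle_length n \<pi>) \<le> real n * \<epsilon>")
    case False
    then show ?thesis using A0 B0 small_count_mono[OF KM] by simp
  next
    case True
    then have "largest_cycle_length n \<pi> \<le> M" by (simp add: M_def le_nat_floor)
    then have SM: "small_count n M \<pi> = real n" by (rule largest_cycle_le_imp_small_count[OF \<pi> n])
    show ?thesis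
    proof (cases "small_count n K \<pi> \<le> real n - \<theta> * real n / 2")
      case True
      then have "1 \<le> A * (small_count n M \<pi> - small_count n K \<pi>)"
        using n0 \<theta> unfolding SM by (simp add: A_def field_simps)
      moreover have "0 \<le> B * (small_count n K \<pi> - \<mu>)\<^sup>2" using B0 by simp
      ultimately show ?thesis by (simp add: of_bool_def)
    next
      case False
      moreover have "\<mu> \<le> (1 - 3 / 4 * \<theta>) * real n" using assms(7) by (simp add: \<mu>_def t_def)
      ultimately have "\<theta> * real n / 4 \<le> small_count n K \<pi> - \<mu>"
        by (simp add: algebra_simps)
      then have "(\<theta> * real n / 4)\<^sup>2 \<le> (small_count n K \<pi> - \<mu>)\<^sup>2"
        using \<theta> by (intro power_mono) auto
      then have "B * (\<theta> * real n / 4)\<^sup>2 \<le> B * (small_count n K \<pi> - \<mu>)\<^sup>2"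
        using B0 by (rule mult_left_mono)
      moreover have "B * (\<theta> * real n / 4)\<^sup>2 = 1"
        using \<theta> n0 by (simp add: B_def field_simps power2_eq_square)
      moreover have "0 \<le> A * (small_count n M \<pi> - small_count n K \<pi>)"
        using A0 small_count_mono[OF KM] by simp
      ultimately show ?thesis by (simp add: of_bool_def)
    qed
  qed
  have "mean n t (\<lambda>\<pi>. of_bool (real (largest_cycle_length n \<pi>) \<le> real n * \<epsilon>)) \<le>
      mean n t (\<lambda>\<pi>. A * (small_count n M \<pi> - small_count n K \<pi>) + B * (small_count n K \<pi> - \<mu>)\<^sup>2)"
    by (rule mean_le[OF n t le])
  also have "\<dots> = A * (mean n t (small_count n M) - mean n t (small_count n K)) +
      B * mean n t (\<lambda>\<pi>. (small_count n K \<pi> - \<mu>)\<^sup>2)"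
    by (simp only: mean_add mean_cmult mean_diff)
  also have "mean n t (small_count n M) - mean n t (small_count n K) =
      (\<Sum>k=Suc K..M. mean n t (cycle_count n k))"
  proof -
    have "{1..M} = {1..K} \<union> {Suc K..M}" using KM by auto
    then show ?thesis
      unfolding mean_small_count by (simp add: sum.union_disjoint)
  qed
  also have "\<dots> \<le> real n * (\<epsilon> + \<rho> ^ Suc K / (1 - \<rho>))"
    unfolding t_def by (rule sum_mean_medium_le[OF c n M Mn \<rho>])
  \<comment> \<open>The variance is of order \<open>n\<close>, while the squared deviation required
    is of order \<open>n^2\<close>.\<close>
  also have "mean n t (\<lambda>\<pi>. (small_count n K \<pi> - \<mu>)\<^sup>2) \<le> 4 * c * real n * (real K)\<^sup>2"
  proof -
    have "mean n t (\<lambda>\<pi>. (small_count n K \<pi> - \<mu>)\<^sup>2) =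
        mean n t (\<lambda>\<pi>. (small_count n K \<pi>)\<^sup>2 - (2 * \<mu>) * small_count n K \<pi> + \<mu>\<^sup>2 * 1)"
      by (simp add: power2_diff algebra_simps)
    also have "\<dots> = mean n t (\<lambda>\<pi>. (small_count n K \<pi>)\<^sup>2) - \<mu>\<^sup>2"
      unfolding mean_add mean_diff mean_cmult mean_const \<mu>_def[symmetric] by (simp add: power2_eq_square)
    also have "\<dots> \<le> t * real (card (transps n)) * (2 * real K)\<^sup>2"
      unfolding \<mu>_def using law_nonneg[OF n] small_count_Lipschitz by (intro variance_bound[OF t]) auto
    also have "\<dots> \<le> t * (real n)\<^sup>2 * (2 * real K)\<^sup>2"
      using card_transps_le[of n] t by (intro mult_right_mono mult_left_mono) (auto simp flip: of_nat_power)
    also have "\<dots> = 4 * c * real n * (real K)\<^sup>2"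
      using n0 by (simp add: t_def power2_eq_square)
    finally show ?thesis .
  qed
  finally have "mean n t (\<lambda>\<pi>. of_bool (real (largest_cycle_length n \<pi>) \<le> real n * \<epsilon>)) \<le>
      A * (real n * (\<epsilon> + \<rho> ^ Suc K / (1 - \<rho>))) + B * (4 * c * real n * (real K)\<^sup>2)"
    using A0 B0 by (simp add: mult_left_mono)
  also have "A * (real n * (\<epsilon> + \<rho> ^ Suc K / (1 - \<rho>))) = 2 / \<theta> * (\<epsilon> + \<rho> ^ Suc K / (1 - \<rho>))"
    using n0 by (simp add: A_def)
  also have "B * (4 * c * real n * (real K)\<^sup>2) = 64 * c * (real K)\<^sup>2 / \<theta>\<^sup>2 / real n"
    using n0 by (simp add: B_def power2_eq_square)
  finally show ?thesis by (simp add: t_def)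
qed

text \<open>The choices are made in the order \<open>\<epsilon>\<close>, \<open>\<rho>\<close>,
  \<open>K\<close>, \<open>n\<close>: first \<open>K\<close> makes the geometric tail smaller than
  \<open>\<epsilon>\<close>, then large \<open>n\<close> makes the variance term smaller than
  \<open>\<epsilon> / \<theta>\<close>.\<close>

lemma small_cycles_eventually:
  assumes c: "1 < c"
  obtains \<theta> \<epsilon>0 :: real where "0 < \<theta>" "0 < \<epsilon>0"
    "\<And>\<epsilon>. 0 < \<epsilon> \<Longrightarrow> \<epsilon> < \<epsilon>0 \<Longrightarrow> \<forall>\<^sub>F n in sequentially.
      mean n (c / real n) (\<lambda>\<pi>. of_bool (real (largest_cycle_length n \<pi>) \<le> real n * \<epsilon>)) \<le> 5 * \<epsilon> / \<theta>"
proof -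
  obtain \<theta> where \<theta>: "0 < \<theta>" "\<And>K. (\<Sum>k=1..K. borel_weight c k) \<le> 1 - \<theta>"
    using sum_borel_weight_supercritical[OF c] by blast
  \<comment> \<open>At \<open>\<epsilon> = 0\<close> the ratio is \<open>c * exp (1 - c)\<close>,
    below 1 for \<open>c > 1\<close>; by continuity it stays below 1 for small
    \<open>\<epsilon>\<close>.\<close>
  have "((\<lambda>\<epsilon>. c * exp (1 - c * (1 - \<epsilon>))) \<longlongrightarrow> c * exp (1 - c * (1 - 0))) (at_right 0)"
    by (intro tendsto_intros)
  moreover have "c * exp (1 - c * (1 - 0)) < 1"
  proof -
    have "c < exp (c - 1)" using exp_lower_Taylor_quadratic[of "c - 1"] zero_less_power[of "c - 1" 2] c by linarith
    then have "c * exp (1 - c) < exp (c - 1) * exp (1 - c)" by (intro mult_strict_right_mono) auto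
    then show ?thesis by (simp flip: exp_add)
  qed
  ultimately have "\<forall>\<^sub>F \<epsilon> in at_right 0. c * exp (1 - c * (1 - \<epsilon>)) < 1"
    by (rule order_tendstoD(2))
  then obtain b where b: "0 < b" "\<And>\<epsilon>. 0 < \<epsilon> \<Longrightarrow> \<epsilon> < b \<Longrightarrow> c * exp (1 - c * (1 - \<epsilon>)) < 1"
    unfolding eventually_at_right_field by auto
  show ?thesis
  proof (rule that[OF \<theta>(1), of "min b 1"])
    fix \<epsilon> :: real assume \<epsilon>: "0 < \<epsilon>" "\<epsilon> < min b 1"
    define \<rho> where "\<rho> = c * exp (1 - c * (1 - \<epsilon>))"
    have \<rho>: "0 < \<rho>" "\<rho> < 1" using b(2)[of \<epsilon>] \<epsilon> c by (auto simp: \<rho>_def)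
    have "(\<lambda>K. \<rho> ^ Suc K / (1 - \<rho>)) \<longlonglongrightarrow> 0 / (1 - \<rho>)"
      using \<rho> by (intro tendsto_divide tendsto_const LIMSEQ_Suc LIMSEQ_power_zero) auto
    then have "\<forall>\<^sub>F K in sequentially. \<rho> ^ Suc K / (1 - \<rho>) < \<epsilon>"
      by (rule order_tendstoD(2)) (use \<epsilon> in simp)
    then obtain K where K: "\<rho> ^ Suc K / (1 - \<rho>) < \<epsilon>"
      by (auto simp: eventually_sequentially)
    have "(\<lambda>n. 64 * c * (real K)\<^sup>2 / \<theta>\<^sup>2 / real n) \<longlonglongrightarrow> 0" by real_asymp
    then have "\<forall>\<^sub>F n in sequentially. 64 * c * (real K)\<^sup>2 / \<theta>\<^sup>2 / real n < \<epsilon> / \<theta>"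
      by (rule order_tendstoD(2)) (use \<epsilon> \<theta> in simp)
    moreover have "\<forall>\<^sub>F n in sequentially. real K \<le> \<epsilon> * real n"
      using \<epsilon>(1) by real_asymp
    ultimately show "\<forall>\<^sub>F n in sequentially.
      mean n (c / real n) (\<lambda>\<pi>. of_bool (real (largest_cycle_length n \<pi>) \<le> real n * \<epsilon>)) \<le> 5 * \<epsilon> / \<theta>"
      using mean_small_count_eventually_le[OF c \<theta>(2,1), of K] eventually_ge_at_top[of 1]
    proof eventually_elim
      case (elim n)
      have "mean n (c / real n) (\<lambda>\<pi>. of_bool (real (largest_cycle_length n \<pi>) \<le> real n * \<epsilon>)) \<le>
          2 / \<theta> * (\<epsilon> + \<rho> ^ Suc K / (1 - \<rho>)) + 64 * c * (real K)\<^sup>2 / \<theta>\<^sup>2 / real n"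
        using \<epsilon> \<rho> by (intro small_cycles_prob_bound[OF c elim(4) \<theta>(1)] elim) (auto simp: \<rho>_def)
      also have "\<dots> \<le> 2 / \<theta> * (\<epsilon> + \<epsilon>) + \<epsilon> / \<theta>"
        using elim(1) K \<theta>(1) by (intro add_mono mult_left_mono) auto
      also have "\<dots> = 5 * \<epsilon> / \<theta>" by (simp add: field_simps)
      finally show ?case .
    qed
  qed (use b in auto)
qed

end

theorem theorem3:
  fixes c :: real
    and M :: "nat \<Rightarrow> 'a measure"
    and \<sigma> :: "nat \<Rightarrow> real \<Rightarrow> 'a \<Rightarrow> nat \<Rightarrow> nat"
  assumes "c > 1"
    and "\<And>n. n \<ge> 1 \<Longrightarrow> interchange_process (M n) n (\<sigma> n)"
  shows "((\<lambda>\<epsilon>::real. liminf (\<lambda>n. ereal (measure (M n)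
            {\<omega> \<in> space (M n). real (largest_cycle_length n (\<sigma> n (c / real n) \<omega>)) > real n * \<epsilon>})))
          \<longlongrightarrow> 1) (at_right 0)"
proof -
  \<comment> \<open>The given processes supply the nonnegativity assumed in the estimates.\<close>
  have law: "0 \<le> law n t \<pi>" if "1 \<le> n" "0 \<le> t" "\<pi> permutes {1..n}" for n t \<pi>
    using interchange_process.law_nonneg[OF assms(2)[OF that(1)] that(2,3)] .
  obtain \<theta> \<epsilon>0 where \<theta>: "0 < \<theta>" "0 < \<epsilon>0" and small:
    "\<And>\<epsilon>. 0 < \<epsilon> \<Longrightarrow> \<epsilon> < \<epsilon>0 \<Longrightarrow> \<forall>\<^sub>F n in sequentially.
      mean n (c / real n) (\<lambda>\<pi>. of_bool (real (largest_cycle_length n \<pi>) \<le> real n * \<epsilon>)) \<le> 5 * \<epsilon> / \<theta>"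
    using small_cycles_eventually[OF law \<open>c > 1\<close>] by blast
  define P where "P \<epsilon> n = measure (M n)
      {\<omega> \<in> space (M n). real (largest_cycle_length n (\<sigma> n (c / real n) \<omega>)) > real n * \<epsilon>}" for \<epsilon> n
  have P_eq: "P \<epsilon> n = 1 - mean n (c / real n) (\<lambda>\<pi>. of_bool (real (largest_cycle_length n \<pi>) \<le> real n * \<epsilon>))"
    if "1 \<le> n" for \<epsilon> n
  proof -
    have "P \<epsilon> n = mean n (c / real n) (\<lambda>\<pi>. of_bool (real (largest_cycle_length n \<pi>) > real n * \<epsilon>))"
      unfolding P_def using \<open>c > 1\<close>
      by (intro interchange_process.prob_state[OF assms(2)[OF that], of "c / real n" "\<lambda>\<pi>. real (largest_cycle_length n \<pi>) > real n * \<epsilon>"]) auto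
    also have "\<dots> = mean n (c / real n) (\<lambda>\<pi>. 1 - of_bool (real (largest_cycle_length n \<pi>) \<le> real n * \<epsilon>))"
      by (intro mean_cong) auto
    finally show ?thesis by (simp only: mean_diff mean_const)
  qed
  have upper: "liminf (\<lambda>n. ereal (P \<epsilon> n)) \<le> 1" for \<epsilon>
  proof -
    have "\<forall>\<^sub>F n in sequentially. ereal (P \<epsilon> n) \<le> 1"
      using eventually_ge_at_top[of 1]
    proof eventually_elim
      case (elim n)
      interpret interchange_process "M n" n "\<sigma> n" by (rule assms(2)[OF elim])
      show ?case unfolding P_def by simp
    qed
    then have "limsup (\<lambda>n. ereal (P \<epsilon> n)) \<le> 1" by (rule Limsup_bounded)
    then show ?thesis
      using Liminf_le_Limsup[of sequentially "\<lambda>n. ereal (P \<epsilon> n)"] by simp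
  qed
  have lower: "ereal (1 - 5 * \<epsilon> / \<theta>) \<le> liminf (\<lambda>n. ereal (P \<epsilon> n))" if "0 < \<epsilon>" "\<epsilon> < \<epsilon>0" for \<epsilon>
  proof (rule Liminf_bounded)
    show "\<forall>\<^sub>F n in sequentially. ereal (1 - 5 * \<epsilon> / \<theta>) \<le> ereal (P \<epsilon> n)"
      using small[OF that] eventually_ge_at_top[of 1]
      by eventually_elim (simp add: P_eq)
  qed
  have "((\<lambda>\<epsilon>. ereal (1 - 5 * \<epsilon> / \<theta>)) \<longlongrightarrow> ereal (1 - 5 * 0 / \<theta>)) (at_right 0)"
    using \<theta>(1) by (intro tendsto_intros) auto
  then have "((\<lambda>\<epsilon>. ereal (1 - 5 * \<epsilon> / \<theta>)) \<longlongrightarrow> 1) (at_right 0)"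
    by (simp add: one_ereal_def)
  \<comment> \<open>The lower bound tends to 1 because \<open>\<theta>\<close> was fixed before
    \<open>\<epsilon>\<close>; the upper bound is the trivial one for probabilities.\<close>
  then have "((\<lambda>\<epsilon>. liminf (\<lambda>n. ereal (P \<epsilon> n))) \<longlongrightarrow> 1) (at_right 0)"
  proof (rule tendsto_sandwich[rotated 2])
    show "((\<lambda>\<epsilon>. 1 :: ereal) \<longlongrightarrow> 1) (at_right (0 :: real))" by simp
    show "\<forall>\<^sub>F \<epsilon> in at_right 0. ereal (1 - 5 * \<epsilon> / \<theta>) \<le> liminf (\<lambda>n. ereal (P \<epsilon> n))"
      unfolding eventually_at_right_field using \<theta>(2) lower by blast
    show "\<forall>\<^sub>F \<epsilon> in at_right 0. liminf (\<lambda>n. ereal (P \<epsilon> n)) \<le> 1"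
      using upper by simp
  qed
  then show ?thesis by (simp only: P_def)
qed

end
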